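(* There is an absolute constant $C>0$ such that the following holds. Let $\mathcal A\subseteq S_n$ with $|\mathcal A|=c\,n!$, where $0<c<1$, and let $\delta_0\ge 0$. If $|\partial\mathcal A|\le (1-c+\delta_0)\,n\,|\mathcal A|$, then there exists a dictatorship $\mathcal B\subseteq S_n$ with \[\frac{|\mathcal A\triangle\mathcal B|}{n!}\le \frac{C}{c(1-c)}\left((c\delta_0)^{1/7}+\frac{1}{n^{1/3}}\right).\]
   Context: $S_n$ is the symmetric group on $[n]$. The transposition graph is the Cayley graph on $S_n$ generated by the transpositions: $\sigma,\tau$ are adjacent iff $\sigma\tau^{-1}$ is a transposition. For $\mathcal A\subseteq S_n$, $\partial\mathcal A$ is the set of edges of this graph with exactly one endpoint in $\mathcal A$. For $i,j\in[n]$, $T_{ij}=\{\pi\in S_n:\pi(i)=j\}$. A dictatorship is a subset of $S_n$ that is a union of pairwise disjoint sets $T_{ij}$ (equivalently, a set determined by the image of a single element or by the pre-image of a single element). *)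

theory Defs
  imports Complex_Main "HOL-Combinatorics.Permutations" "HOL-Combinatorics.Transposition"
begin

definition Sym :: "nat \<Rightarrow> (nat \<Rightarrow> nat) set" where
  "Sym n = {p. p permutes {1..n}}"

definition trans_adj :: "nat \<Rightarrow> (nat \<Rightarrow> nat) \<Rightarrow> (nat \<Rightarrow> nat) \<Rightarrow> bool" where
  "trans_adj n \<sigma> \<tau> \<longleftrightarrow> \<sigma> \<in> Sym n \<and> \<tau> \<in> Sym n \<and>
     (\<exists>a\<in>{1..n}. \<exists>b\<in>{1..n}. a \<noteq> b \<and> \<sigma> \<circ> inv \<tau> = transpose a b)"

text \<open>Edge boundary: edges with exactly one endpoint in A, each edge represented
  once as the pair (endpoint in A, endpoint outside A).\<close>
definition edge_boundary :: "nat \<Rightarrow> (nat \<Rightarrow> nat) set \<Rightarrow> ((nat \<Rightarrow> nat) \<times> (nat \<Rightarrow> nat)) set" where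
  "edge_boundary n A = {(\<sigma>, \<tau>). \<sigma> \<in> A \<and> \<tau> \<in> Sym n - A \<and> trans_adj n \<sigma> \<tau>}"

definition T_set :: "nat \<Rightarrow> nat \<Rightarrow> nat \<Rightarrow> (nat \<Rightarrow> nat) set" where
  "T_set n i j = {\<pi> \<in> Sym n. \<pi> i = j}"

definition dictatorship :: "nat \<Rightarrow> (nat \<Rightarrow> nat) set \<Rightarrow> bool" where
  "dictatorship n B \<longleftrightarrow> (\<exists>P \<subseteq> {1..n} \<times> {1..n}.
     (\<forall>p\<in>P. \<forall>q\<in>P. p \<noteq> q \<longrightarrow> T_set n (fst p) (snd p) \<inter> T_set n (fst q) (snd q) = {}) \<and>
     B = (\<Union>p\<in>P. T_set n (fst p) (snd p)))"

end

theory Submission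
  imports Defs
begin

text \<open>
  For \<open>f\<close> the indicator of \<open>A\<close>, write \<open>D\<^bsub>ab\<^esub> f p = f p - f (p \<circ> (a b))\<close> and let \<open>\<psi>\<^bsub>ab\<^esub>\<close> be its average over all
  permutations with the same values at \<open>a\<close> and \<open>b\<close>.  The Laplacian \<open>L\<close> of the transposition walk satisfies a bound
  of the form \<open>L\<^sup>2 \<ge> n L + D\<close>, where \<open>D\<close> collects the products of disjoint transpositions; together with
  the spectral gap and applied to the solution \<open>G\<close> of the Poisson equation \<open>L G = n (f - c)\<close>, it shows
  that a boundary of nearly minimal size forces \<open>D\<^bsub>ab\<^esub> f\<close> to be close to \<open>\<psi>\<^bsub>ab\<^esub>\<close> on average.

  Call \<open>(a, b, x, y)\<close> a rectangle if \<open>|\<psi>\<^bsub>ab\<^esub>| > 1/2\<close> at the permutations with \<open>a \<mapsto> x\<close>, \<open>b \<mapsto> y\<close>.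
  Since \<open>f\<close> is Boolean, two disjoint rectangles of opposite sign at the same permutation contradict
  the approximation \<open>D\<^bsub>ab\<^esub> f \<approx> \<psi>\<^bsub>ab\<^esub>\<close>, so few pairs of rectangles are disjoint, and nearly all
  rectangles pass through one row \<open>i\<close> or one column \<open>j\<close>.  By the spectral gap on the remaining
  points, \<open>f\<close> is then close to a function of \<open>p i\<close>, respectively of \<open>p\<^sup>-\<^sup>1 j\<close>, and rounding it gives
  the dictatorship.
\<close>

subsection \<open>The Laplacian of the transposition walk\<close>

text \<open>The lower bound on \<open>L^2\<close> cannot be used on \<open>f\<close> itself: the
  hypothesis controls \<open><f, L f>\<close>, but not \<open>|L f|^2\<close>, which sees how
  unevenly the boundary is spread. For the Poisson solution \<open>G\<close> the number
  \<open>|L G|^2\<close> is known exactly, and since \<open>L\<close> commutes with right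
  translations, what is learnt about \<open>G\<close> can be carried back to \<open>f\<close>.

  The second obstacle is a size bound. At one permutation the rectangles of one sign are paid for by
  the error, but each may be paired with up to \<open>n^2\<close> rectangles of the other sign; only
  on average are there \<open>O(n)\<close> of them. This average survives conditioning on the values
  at the four positions of a pair, which permits a truncation in the style of Markov.

  The final loss comes from square roots. With \<open>\<eta> = c * \<delta>\<^sub>0\<close> there
  are \<open>O(\<eta> n^6)\<close> disjoint pairs of rectangles, and \<open>O(n^5)\<close> pairs
  through two given lines meet in a further line, so \<open>O(sqrt \<eta> n^3 + n^(5/2))\<close>
  rectangles avoid the chosen line. The resulting rate \<open>sqrt \<eta> + 1 / sqrt n\<close> is
  stronger than the claimed one.\<close>

definition ip :: "nat \<Rightarrow> ((nat \<Rightarrow> nat) \<Rightarrow> real) \<Rightarrow> ((nat \<Rightarrow> nat) \<Rightarrow> real) \<Rightarrow> real" where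
  "ip n g h = (\<Sum>p\<in>Sym n. g p * h p)"

definition sq :: "nat \<Rightarrow> ((nat \<Rightarrow> nat) \<Rightarrow> real) \<Rightarrow> real" where
  "sq n g = (\<Sum>p\<in>Sym n. (g p)\<^sup>2)"

definition dif :: "nat \<Rightarrow> nat \<Rightarrow> ((nat \<Rightarrow> nat) \<Rightarrow> real) \<Rightarrow> (nat \<Rightarrow> nat) \<Rightarrow> real" where
  "dif a b g p = g p - g (p \<circ> transpose a b)"

text \<open>Ordered pairs are summed, so every transposition counts twice: for
  \<open>X = {1..n}\<close> this is twice the Laplacian of the transposition graph. Swaps act on
  positions here, whereas \<open>trans_adj\<close> swaps values.\<close>

definition lap :: "nat set \<Rightarrow> ((nat \<Rightarrow> nat) \<Rightarrow> real) \<Rightarrow> (nat \<Rightarrow> nat) \<Rightarrow> real" where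
  "lap X g p = (\<Sum>a\<in>X. \<Sum>b\<in>X. dif a b g p)"

definition ener :: "nat \<Rightarrow> nat set \<Rightarrow> ((nat \<Rightarrow> nat) \<Rightarrow> real) \<Rightarrow> real" where
  "ener n X g = (\<Sum>a\<in>X. \<Sum>b\<in>X. sq n (dif a b g))"

text \<open>The conditional expectation given the values off \<open>X\<close>.\<close>

definition av :: "nat set \<Rightarrow> ((nat \<Rightarrow> nat) \<Rightarrow> real) \<Rightarrow> (nat \<Rightarrow> nat) \<Rightarrow> real" where
  "av X g p = (\<Sum>s | s permutes X. g (p \<circ> s)) / fact (card X)"

lemma finite_Sym [simp]: "finite (Sym n)"
  by (simp add: Sym_def finite_permutations)

lemma card_Sym: "card (Sym n) = fact n"
  by (simp add: Sym_def card_permutations)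

lemma Sym_comp: "p \<in> Sym n \<Longrightarrow> q \<in> Sym n \<Longrightarrow> p \<circ> q \<in> Sym n"
  by (simp add: Sym_def permutes_compose)

lemma Sym_comp_permutes: "p \<in> Sym n \<Longrightarrow> X \<subseteq> {1..n} \<Longrightarrow> s permutes X \<Longrightarrow> p \<circ> s \<in> Sym n"
  by (rule Sym_comp) (auto simp: Sym_def intro: permutes_subset)

lemma Sym_transpose: "p \<in> Sym n \<Longrightarrow> a \<in> {1..n} \<Longrightarrow> b \<in> {1..n} \<Longrightarrow> p \<circ> transpose a b \<in> Sym n"
  by (rule Sym_comp) (auto simp: Sym_def intro: permutes_swap_id)

lemma sum_Sym_right: "s permutes X \<Longrightarrow> X \<subseteq> {1..n} \<Longrightarrow> (\<Sum>p\<in>Sym n. g (p \<circ> s)) = (\<Sum>p\<in>Sym n. g p)"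
  unfolding Sym_def by (rule sum_permutations_compose_right[symmetric]) (rule permutes_subset)

lemma sum_Sym_transpose:
  "a \<in> {1..n} \<Longrightarrow> b \<in> {1..n} \<Longrightarrow> (\<Sum>p\<in>Sym n. g (p \<circ> transpose a b)) = (\<Sum>p\<in>Sym n. g p)"
  by (rule sum_Sym_right[of _ "{1..n}"]) (auto intro: permutes_swap_id)

lemma ip_commute: "ip n g h = ip n h g"
  by (simp add: ip_def mult.commute)

lemma sq_ip: "sq n g = ip n g g"
  by (simp add: ip_def sq_def power2_eq_square)

lemma sq_nonneg [simp]: "0 \<le> sq n g"
  by (simp add: sq_def sum_nonneg)

lemma ener_nonneg: "0 \<le> ener n X g"
  by (simp add: ener_def sum_nonneg)

lemma sq_cong: "(\<And>p. p \<in> Sym n \<Longrightarrow> g p = h p) \<Longrightarrow> sq n g = sq n h"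
  by (simp add: sq_def)

lemma ip_cong: "(\<And>p. p \<in> Sym n \<Longrightarrow> g p = g' p) \<Longrightarrow> (\<And>p. p \<in> Sym n \<Longrightarrow> h p = h' p) \<Longrightarrow> ip n g h = ip n g' h'"
  by (simp add: ip_def)

lemma dif_same [simp]: "dif a a g p = 0"
  by (simp add: dif_def)

lemma dif_commute: "dif a b g = dif b a g"
  by (rule ext) (simp add: dif_def transpose_commute)

text \<open>\<open>dif a b\<close> is \<open>1 - T\<close> for a self-adjoint involution
  \<open>T\<close>, so it is self-adjoint and its square is twice itself.\<close>

lemma ip_dif_right:
  assumes "a \<in> {1..n}" "b \<in> {1..n}"
  shows "ip n u (dif a b v) = ip n (dif a b u) (dif a b v) / 2"
proof -
  have "(\<Sum>p\<in>Sym n. u p * dif a b v p) = (\<Sum>p\<in>Sym n. u (p \<circ> transpose a b) * dif a b v (p \<circ> transpose a b))"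
    by (rule sum_Sym_transpose[OF assms, symmetric])
  also have "\<dots> = - (\<Sum>p\<in>Sym n. u (p \<circ> transpose a b) * dif a b v p)"
    by (simp add: dif_def comp_assoc algebra_simps sum_subtractf)
  finally have "2 * ip n u (dif a b v) = (\<Sum>p\<in>Sym n. u p * dif a b v p) - (\<Sum>p\<in>Sym n. u (p \<circ> transpose a b) * dif a b v p)"
    unfolding ip_def by linarith
  also have "\<dots> = ip n (dif a b u) (dif a b v)"
    unfolding ip_def dif_def[of a b u] by (simp add: sum_subtractf algebra_simps)
  finally show ?thesis by simp
qed

lemma ip_sum_right: "ip n u (\<lambda>p. \<Sum>i\<in>I. v i p) = (\<Sum>i\<in>I. ip n u (v i))"
  unfolding ip_def by (simp add: sum_distrib_left sum.swap[of _ I])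

lemma ip_lap:
  assumes "X \<subseteq> {1..n}"
  shows "ip n u (lap X v) = (\<Sum>a\<in>X. \<Sum>b\<in>X. ip n (dif a b u) (dif a b v)) / 2"
proof -
  have "ip n u (lap X v) = (\<Sum>a\<in>X. \<Sum>b\<in>X. ip n u (dif a b v))"
    unfolding lap_def[abs_def] by (simp add: ip_sum_right)
  also have "\<dots> = (\<Sum>a\<in>X. \<Sum>b\<in>X. ip n (dif a b u) (dif a b v) / 2)"
    using assms by (intro sum.cong refl ip_dif_right) auto
  finally show ?thesis by (simp add: sum_divide_distrib)
qed

lemma ip_lap_self: "X \<subseteq> {1..n} \<Longrightarrow> ip n g (lap X g) = ener n X g / 2"
  by (simp add: ip_lap ener_def sq_ip)

lemma sq_diff_scale: "sq n (\<lambda>p. g p - k * h p) = sq n g - 2 * k * ip n g h + k\<^sup>2 * sq n h"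
  unfolding sq_def ip_def
  by (simp add: power2_eq_square algebra_simps sum.distrib sum_subtractf sum_distrib_left)

lemma dif_diff_scale: "dif a b (\<lambda>p. g p - k * h p) = (\<lambda>p. dif a b g p - k * dif a b h p)"
  by (rule ext) (simp add: dif_def algebra_simps)

lemma lap_diff_scale: "lap X (\<lambda>p. g p - k * h p) p = lap X g p - k * lap X h p"
  by (simp add: lap_def dif_diff_scale sum_subtractf sum_distrib_left)

lemma ener_diff_scale:
  assumes "X \<subseteq> {1..n}"
  shows "ener n X (\<lambda>p. g p - k * h p) = ener n X g - 4 * k * ip n g (lap X h) + k\<^sup>2 * ener n X h"
  unfolding ener_def ip_lap[OF assms]
  by (simp add: dif_diff_scale sq_diff_scale sum.distrib sum_subtractf mult.assoc flip: sum_distrib_left)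

section \<open>Averaging over the permutations of a set of positions\<close>

lemma av_permute:
  assumes "t permutes X"
  shows "av X g (p \<circ> t) = av X g p"
  using setum_permutations_compose_left[OF assms, of "\<lambda>s. g (p \<circ> s)"]
  by (simp add: av_def comp_assoc)

lemma av_comp:
  assumes "t permutes X"
  shows "av X (\<lambda>p. g (p \<circ> t)) p = av X g p"
  using sum_permutations_compose_right[OF assms, of "\<lambda>s. g (p \<circ> s)"]
  by (simp add: av_def comp_assoc)

lemma av_invariant:
  assumes "finite X" and "\<And>s. s permutes X \<Longrightarrow> g (p \<circ> s) = g p"
  shows "av X g p = g p"
  using assms card_permutations[OF refl assms(1)] by (simp add: av_def)

lemma av_diff_scale: "av X (\<lambda>p. g p - k * h p) p = av X g p - k * av X h p"
  by (simp add: av_def sum_subtractf sum_distrib_left diff_divide_distrib)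

lemma av_diff: "av X (\<lambda>p. g p - h p) p = av X g p - av X h p"
  using av_diff_scale[of X g 1 h p] by simp

lemma av_dif: "a \<in> X \<Longrightarrow> b \<in> X \<Longrightarrow> av X (dif a b g) p = 0"
  unfolding dif_def[abs_def] by (simp add: av_diff av_comp permutes_swap_id)

lemma av_sum: "av X (\<lambda>p. \<Sum>i\<in>I. g i p) p = (\<Sum>i\<in>I. av X (g i) p)"
  by (simp add: av_def sum.swap[of _ _ I] sum_divide_distrib)

lemma av_lap: "av X (lap X g) p = 0"
  unfolding lap_def[abs_def] by (simp add: av_sum av_dif)

lemma dif_av: "a \<in> X \<Longrightarrow> b \<in> X \<Longrightarrow> dif a b (av X g) p = 0"
  by (simp add: dif_def av_permute permutes_swap_id)

lemma sum_Sym_av: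
  assumes "X \<subseteq> {1..n}"
  shows "(\<Sum>p\<in>Sym n. av X g p) = (\<Sum>p\<in>Sym n. g p)"
proof -
  have fin: "finite X" using assms finite_subset by blast
  have "(\<Sum>p\<in>Sym n. av X g p) = (\<Sum>s | s permutes X. \<Sum>p\<in>Sym n. g (p \<circ> s)) / fact (card X)"
    unfolding av_def sum_divide_distrib[symmetric] by (subst sum.swap) simp
  also have "\<dots> = (\<Sum>s | s permutes X. \<Sum>p\<in>Sym n. g p) / fact (card X)"
    by (intro arg_cong2[where f="(/)"] sum.cong refl sum_Sym_right[OF _ assms]) auto
  also have "\<dots> = (\<Sum>p\<in>Sym n. g p)"
    using card_permutations[OF refl fin] by simp
  finally show ?thesis .
qed

lemma av_mult_invariant:
  assumes "\<And>s. s permutes X \<Longrightarrow> u (p \<circ> s) = u p"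
  shows "av X (\<lambda>p. u p * g p) p = u p * av X g p"
  using assms by (simp add: av_def sum_distrib_left)

text \<open>Averaging is self-adjoint and fixes \<open>u\<close>.\<close>

lemma ip_av:
  assumes "X \<subseteq> {1..n}" and "\<And>p s. p \<in> Sym n \<Longrightarrow> s permutes X \<Longrightarrow> u (p \<circ> s) = u p"
  shows "ip n u (av X g) = ip n u g"
proof -
  have "ip n u g = (\<Sum>p\<in>Sym n. av X (\<lambda>p. u p * g p) p)"
    by (simp add: sum_Sym_av[OF assms(1)] ip_def)
  also have "\<dots> = ip n u (av X g)"
    unfolding ip_def using assms(2) by (intro sum.cong refl av_mult_invariant)
  finally show ?thesis by simp
qed

text \<open>Pythagoras for the orthogonal projection \<open>av X\<close>.\<close>

lemma sq_minus_av:
  assumes "X \<subseteq> {1..n}"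
  shows "sq n (\<lambda>p. g p - av X g p) = sq n g - sq n (av X g)"
proof -
  have "ip n (av X g) (av X g) = ip n (av X g) g"
    by (rule ip_av[OF assms]) (simp add: av_permute)
  then show ?thesis
    using sq_diff_scale[of n g 1 "av X g"] by (simp add: sq_ip ip_commute)
qed

lemma sq_triangle: "sq n (\<lambda>p. g p - h p) \<le> 2 * sq n (\<lambda>p. g p - u p) + 2 * sq n (\<lambda>p. u p - h p)"
proof -
  have "sq n (\<lambda>p. g p - h p) \<le> (\<Sum>p\<in>Sym n. 2 * (g p - u p)\<^sup>2 + 2 * (u p - h p)\<^sup>2)"
    unfolding sq_def
  proof (rule sum_mono)
    fix p show "(g p - h p)\<^sup>2 \<le> 2 * (g p - u p)\<^sup>2 + 2 * (u p - h p)\<^sup>2"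
      using zero_le_power2[of "(g p - u p) - (u p - h p)"] by (simp add: power2_eq_square algebra_simps)
  qed
  then show ?thesis by (simp add: sum.distrib sum_distrib_left sq_def)
qed

lemma sq_comp: "s permutes X \<Longrightarrow> X \<subseteq> {1..n} \<Longrightarrow> sq n (\<lambda>p. g (p \<circ> s)) = sq n g"
  unfolding sq_def by (rule sum_Sym_right)

section \<open>A crude gap and the Poisson equation\<close>

lemma sq_dif_le_ener:
  assumes "finite X" "a \<in> X" "b \<in> X"
  shows "sq n (dif a b g) \<le> ener n X g"
proof -
  have "sq n (dif a b g) \<le> (\<Sum>b\<in>X. sq n (dif a b g))"
    using assms by (intro member_le_sum) auto
  also have "\<dots> \<le> ener n X g" unfolding ener_def
    using assms by (intro member_le_sum[of a X "\<lambda>a. \<Sum>b\<in>X. sq n (dif a b g)"] sum_nonneg) auto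
  finally show ?thesis .
qed

text \<open>Induction along a factorisation of \<open>s\<close> into transpositions of
  \<open>X\<close>, with the triangle inequality at each factor.\<close>

lemma sq_translate_le_ener:
  assumes X: "X \<subseteq> {1..n}" and s: "s permutes X"
  shows "\<exists>C\<ge>0. \<forall>g. sq n (\<lambda>p. g p - g (p \<circ> s)) \<le> C * ener n X g"
proof -
  have fin: "finite X" using X finite_subset by blast
  from fin s show ?thesis
  proof (induction rule: permutes_rev_induct)
    case id
    show ?case by (intro exI[of _ 0]) (simp add: sq_def)
  next
    case (swap a b q)
    then obtain C where C: "C \<ge> 0" "\<And>g. sq n (\<lambda>p. g p - g (p \<circ> q)) \<le> C * ener n X g" by blast
    show ?case
    proof (intro exI[of _ "2 * C + 2"] conjI allI)
      fix g
      have "sq n (\<lambda>p. g p - g (p \<circ> (q \<circ> transpose a b))) \<le> 2 * sq n (\<lambda>p. g p - g (p \<circ> q)) +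
          2 * sq n (\<lambda>p. g (p \<circ> q) - g (p \<circ> (q \<circ> transpose a b)))"
        by (rule sq_triangle)
      also have "sq n (\<lambda>p. g (p \<circ> q) - g (p \<circ> (q \<circ> transpose a b))) = sq n (dif a b g)"
        using sq_comp[OF swap.hyps(4) X, of "dif a b g"] by (simp add: dif_def comp_assoc)
      also have "sq n (dif a b g) \<le> ener n X g"
        using swap fin by (intro sq_dif_le_ener) auto
      finally show "sq n (\<lambda>p. g p - g (p \<circ> (q \<circ> transpose a b))) \<le> (2 * C + 2) * ener n X g"
        using C(2)[of g] unfolding distrib_right mult.assoc by linarith
    qed (use C in simp)
  qed
qed

lemma power2_sum_le:
  fixes f :: "'a \<Rightarrow> real"
  shows "(\<Sum>i\<in>I. f i)\<^sup>2 \<le> real (card I) * (\<Sum>i\<in>I. (f i)\<^sup>2)"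
proof -
  have "0 \<le> (\<Sum>i\<in>I. \<Sum>j\<in>I. (f i - f j)\<^sup>2)" by (simp add: sum_nonneg)
  also have "\<dots> = 2 * (real (card I) * (\<Sum>i\<in>I. (f i)\<^sup>2) - (\<Sum>i\<in>I. f i)\<^sup>2)"
    by (simp add: power2_eq_square algebra_simps sum.distrib sum_subtractf sum_product sum_distrib_left)
  finally show ?thesis by simp
qed

text \<open>Only the existence of some gap matters here: it makes the series that solves the Poisson
  equation converge. The sharp constant is derived later from that solution.\<close>

lemma weak_gap:
  assumes X: "X \<subseteq> {1..n}"
  obtains C where "C > 0" "\<And>g. sq n (\<lambda>p. g p - av X g p) \<le> C * ener n X g"
proof -
  have fin: "finite X" using X finite_subset by blast
  obtain c where c: "\<And>s. s permutes X \<Longrightarrow> c s \<ge> 0"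
    "\<And>s g. s permutes X \<Longrightarrow> sq n (\<lambda>p. g p - g (p \<circ> s)) \<le> c s * ener n X g"
    using sq_translate_le_ener[OF X] by metis
  define C where "C = (\<Sum>s | s permutes X. c s)"
  have C0: "C \<ge> 0" unfolding C_def using c by (intro sum_nonneg) auto
  have "sq n (\<lambda>p. g p - av X g p) \<le> (C + 1) * ener n X g" for g
  proof -
    let ?F = "{s. s permutes X}"
    have cardF: "card ?F = fact (card X)" by (rule card_permutations[OF refl fin])
    have "(g p - av X g p)\<^sup>2 \<le> (\<Sum>s\<in>?F. (g p - g (p \<circ> s))\<^sup>2)" for p
    proof -
      have "g p - av X g p = (\<Sum>s\<in>?F. g p - g (p \<circ> s)) / fact (card X)"
        by (simp add: av_def sum_subtractf cardF field_simps)
      then have "(g p - av X g p)\<^sup>2 = (\<Sum>s\<in>?F. g p - g (p \<circ> s))\<^sup>2 / (fact (card X))\<^sup>2"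
        by (simp add: power_divide)
      also have "\<dots> \<le> (fact (card X) * (\<Sum>s\<in>?F. (g p - g (p \<circ> s))\<^sup>2)) / (fact (card X))\<^sup>2"
        using power2_sum_le[of "\<lambda>s. g p - g (p \<circ> s)" ?F] by (intro divide_right_mono) (simp_all add: cardF)
      also have "\<dots> = (\<Sum>s\<in>?F. (g p - g (p \<circ> s))\<^sup>2) / fact (card X)"
        by (simp add: power2_eq_square)
      also have "\<dots> \<le> (\<Sum>s\<in>?F. (g p - g (p \<circ> s))\<^sup>2) / 1"
        by (intro divide_left_mono sum_nonneg) (simp_all add: fact_ge_1)
      finally show ?thesis by simp
    qed
    then have "sq n (\<lambda>p. g p - av X g p) \<le> (\<Sum>p\<in>Sym n. \<Sum>s\<in>?F. (g p - g (p \<circ> s))\<^sup>2)"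
      unfolding sq_def by (rule sum_mono)
    also have "\<dots> = (\<Sum>s\<in>?F. sq n (\<lambda>p. g p - g (p \<circ> s)))"
      unfolding sq_def by (rule sum.swap)
    also have "\<dots> \<le> (\<Sum>s\<in>?F. c s * ener n X g)"
      using c by (intro sum_mono) auto
    also have "\<dots> \<le> (C + 1) * ener n X g"
      by (simp add: C_def sum_distrib_right[symmetric] ener_nonneg algebra_simps)
    finally show ?thesis .
  qed
  with C0 show ?thesis by (intro that[of "C + 1"]) auto
qed

lemma sq_lap_le:
  assumes "finite X"
  shows "sq n (lap X g) \<le> (real (card X))\<^sup>2 * ener n X g"
proof -
  have "(lap X g p)\<^sup>2 \<le> (real (card X))\<^sup>2 * (\<Sum>a\<in>X. \<Sum>b\<in>X. (dif a b g p)\<^sup>2)" for p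
    using power2_sum_le[of "\<lambda>z. dif (fst z) (snd z) g p" "X \<times> X"]
    by (simp add: lap_def sum.cartesian_product case_prod_beta card_cartesian_product power2_eq_square)
  then have "sq n (lap X g) \<le> (\<Sum>p\<in>Sym n. (real (card X))\<^sup>2 * (\<Sum>a\<in>X. \<Sum>b\<in>X. (dif a b g p)\<^sup>2))"
    unfolding sq_def by (rule sum_mono)
  also have "\<dots> = (real (card X))\<^sup>2 * ener n X g"
    unfolding ener_def sq_def sum_distrib_left[symmetric]
    by (simp add: sum.swap[of _ X "Sym n"])
  finally show ?thesis .
qed

text \<open>\<open>G\<close> is the Neumann series of \<open>1 - L / M\<close>, divided by
  \<open>M\<close>. The iteration contracts functions whose average over \<open>X\<close> vanishes,
  and the equation results from telescoping.\<close>

lemma poisson: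
  assumes X: "X \<subseteq> {1..n}" and g: "\<And>p. p \<in> Sym n \<Longrightarrow> av X g p = 0"
  obtains G where "\<And>p. p \<in> Sym n \<Longrightarrow> lap X G p = g p"
proof -
  have fin: "finite X" using X finite_subset by blast
  obtain C where C: "C > 0" "\<And>g. sq n (\<lambda>p. g p - av X g p) \<le> C * ener n X g"
    using weak_gap[OF X] by blast
  \<comment> \<open>\<open>M / 2\<close> exceeds the factor \<open>(card X)^2\<close> of
    \<open>sq_lap_le\<close>, so the quadratic term of an iteration consumes at most half of the
    linear gain. The maximum in \<open>th\<close> keeps its square root usable as a geometric ratio
    when \<open>C\<close> happens to be small.\<close>
  define M where "M = 2 * (real (card X))\<^sup>2 + 1"
  define th where "th = max 0 (1 - 1 / (2 * M * C))"
  have M: "M > 0" by (simp add: M_def add_nonneg_pos)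
  have th: "0 \<le> th" "th < 1" using M C by (auto simp: th_def)
  define r where "r t = ((\<lambda>u p. u p - (1/M) * lap X u p) ^^ t) g" for t
  have r0: "r 0 = g" by (simp add: r_def)
  have rS: "r (Suc t) = (\<lambda>p. r t p - (1/M) * lap X (r t) p)" for t by (simp add: r_def)
  have av0: "av X (r t) p = 0" if "p \<in> Sym n" for t p
  proof (induction t)
    case 0 then show ?case using g that by (simp add: r0)
  next
    case (Suc t) then show ?case unfolding rS av_diff_scale by (simp add: av_lap)
  qed
  have step: "sq n (r (Suc t)) \<le> th * sq n (r t)" for t
  proof -
    have "sq n (r (Suc t)) = sq n (r t) - ener n X (r t) / M + sq n (lap X (r t)) / M\<^sup>2"
      unfolding rS sq_diff_scale by (simp add: ip_lap_self[OF X] power_divide)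
    also have "sq n (lap X (r t)) / M\<^sup>2 \<le> (M / 2 * ener n X (r t)) / M\<^sup>2"
    proof (rule divide_right_mono)
      have "sq n (lap X (r t)) \<le> (real (card X))\<^sup>2 * ener n X (r t)" by (rule sq_lap_le[OF fin])
      also have "\<dots> \<le> M / 2 * ener n X (r t)"
        by (intro mult_right_mono ener_nonneg) (simp add: M_def)
      finally show "sq n (lap X (r t)) \<le> M / 2 * ener n X (r t)" .
    qed simp
    also have "sq n (r t) - ener n X (r t) / M + (M / 2 * ener n X (r t)) / M\<^sup>2 = sq n (r t) - ener n X (r t) / (2 * M)"
      using M by (simp add: field_simps power2_eq_square)
    also have "\<dots> \<le> sq n (r t) - (sq n (r t) / C) / (2 * M)"
    proof -
      have "sq n (r t) = sq n (\<lambda>p. r t p - av X (r t) p)" by (rule sq_cong) (simp add: av0)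
      then have "sq n (r t) \<le> C * ener n X (r t)" using C(2)[of "r t"] by simp
      then have "sq n (r t) / C \<le> ener n X (r t)" using C(1) by (simp add: field_simps)
      then have "sq n (r t) / C / (2 * M) \<le> ener n X (r t) / (2 * M)"
        using M by (intro divide_right_mono) simp_all
      then show ?thesis by linarith
    qed
    also have "\<dots> = (1 - 1 / (2 * M * C)) * sq n (r t)" using M C by (simp add: field_simps)
    also have "\<dots> \<le> th * sq n (r t)" by (intro mult_right_mono) (simp_all add: th_def)
    finally show ?thesis by simp
  qed
  have sqr: "sq n (r t) \<le> th ^ t * sq n g" for t
  proof (induction t)
    case 0 then show ?case by (simp add: r0)
  next
    case (Suc t)
    have "sq n (r (Suc t)) \<le> th * (th ^ t * sq n g)"
      using step[of t] mult_left_mono[OF Suc th(1)] by linarith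
    then show ?case by simp
  qed
  have bound: "norm (r t p) \<le> sqrt (sq n g) * sqrt th ^ t" if "p \<in> Sym n" for t p
  proof -
    have "(r t p)\<^sup>2 \<le> sq n (r t)" unfolding sq_def using that by (intro member_le_sum) auto
    then have "(r t p)\<^sup>2 \<le> th ^ t * sq n g" using sqr[of t] by linarith
    then have "sqrt ((r t p)\<^sup>2) \<le> sqrt (th ^ t * sq n g)" by (rule real_sqrt_le_mono)
    then show ?thesis unfolding real_sqrt_abs by (simp add: real_sqrt_mult real_sqrt_power mult.commute)
  qed
  have geo: "summable (\<lambda>t. sqrt (sq n g) * sqrt th ^ t)"
    using th by (intro summable_mult summable_geometric) simp
  have summ: "summable (\<lambda>t. r t p)" if "p \<in> Sym n" for p
    by (rule summable_comparison_test'[OF geo, of 0]) (use bound that in auto)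
  have lim: "(\<lambda>t. r t p) \<longlonglongrightarrow> 0" if "p \<in> Sym n" for p
    using summable_LIMSEQ_zero[OF summ[OF that]] .
  define G where "G p = (\<Sum>t. r t p) / M" for p
  have "lap X G p = g p" if p: "p \<in> Sym n" for p
  proof -
    have "(\<lambda>t. dif a b (r t) p) sums (M * dif a b G p)" if "a \<in> X" "b \<in> X" for a b
    proof -
      have "p \<circ> transpose a b \<in> Sym n" using p that X by (intro Sym_transpose) auto
      then have "(\<lambda>t. r t p - r t (p \<circ> transpose a b)) sums ((\<Sum>t. r t p) - (\<Sum>t. r t (p \<circ> transpose a b)))"
        using p by (intro sums_diff summable_sums summ)
      moreover have "(\<Sum>t. r t p) - (\<Sum>t. r t (p \<circ> transpose a b)) = M * dif a b G p"
        using M by (simp add: dif_def G_def field_simps)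
      ultimately show ?thesis by (simp add: dif_def)
    qed
    then have "(\<lambda>t. lap X (r t) p) sums (\<Sum>a\<in>X. \<Sum>b\<in>X. M * dif a b G p)"
      unfolding lap_def by (intro sums_sum) auto
    then have 1: "(\<lambda>t. lap X (r t) p) sums (M * lap X G p)"
      by (simp add: lap_def sum_distrib_left)
    have "(\<lambda>t. r t p - r (Suc t) p) sums (r 0 p - 0)"
      by (rule telescope_sums'[OF lim[OF p]])
    then have "(\<lambda>t. M * (r t p - r (Suc t) p)) sums (M * (r 0 p - 0))" by (rule sums_mult)
    moreover have "M * (r t p - r (Suc t) p) = lap X (r t) p" for t
      using M by (simp add: rS)
    ultimately have "(\<lambda>t. lap X (r t) p) sums (M * g p)" by (simp add: r0)
    with 1 have "M * lap X G p = M * g p" by (rule sums_unique2)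
    with M show ?thesis by simp
  qed
  then show ?thesis by (rule that)
qed

subsection \<open>The spectral gap\<close>

lemma ip_diff_left: "ip n (\<lambda>p. g p - h p) u = ip n g u - ip n h u"
  by (simp add: ip_def algebra_simps sum_subtractf)

lemma ip_diff_right: "ip n u (\<lambda>p. g p - h p) = ip n u g - ip n u h"
  by (simp add: ip_def algebra_simps sum_subtractf)

lemma ip_dif_dif:
  assumes "a \<in> {1..n}" "b \<in> {1..n}"
  shows "ip n (dif a b g) (dif c d g) = sq n g - ip n g (\<lambda>p. g (p \<circ> transpose a b))
    - ip n g (\<lambda>p. g (p \<circ> transpose c d)) + ip n g (\<lambda>p. g (p \<circ> (transpose a b \<circ> transpose c d)))"
proof -
  have "ip n (\<lambda>p. g (p \<circ> transpose a b)) (\<lambda>p. g (p \<circ> transpose c d))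
      = ip n g (\<lambda>p. g (p \<circ> (transpose a b \<circ> transpose c d)))"
    using sum_Sym_transpose[OF assms, of "\<lambda>p. g (p \<circ> transpose a b) * g (p \<circ> transpose c d)"]
    by (simp add: ip_def comp_assoc)
  then show ?thesis
    unfolding dif_def[abs_def]
    by (simp add: ip_diff_left ip_diff_right sq_ip ip_commute[of n "\<lambda>p. g (p \<circ> transpose a b)" g])
qed

lemma sq_dif:
  assumes "a \<in> {1..n}" "b \<in> {1..n}"
  shows "sq n (dif a b g) = 2 * sq n g - 2 * ip n g (\<lambda>p. g (p \<circ> transpose a b))"
  using ip_dif_dif[OF assms, of g a b] by (simp add: sq_ip)

lemma ip_antisym:
  assumes "a \<in> {1..n}" "b \<in> {1..n}" "\<And>p. w (p \<circ> transpose a b) = - w p"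
  shows "ip n w (\<lambda>p. h (p \<circ> transpose a b)) = - ip n w h"
proof -
  have "ip n w (\<lambda>p. h (p \<circ> transpose a b)) = (\<Sum>p\<in>Sym n. - (w (p \<circ> transpose a b) * h (p \<circ> transpose a b)))"
    by (simp add: ip_def assms(3))
  also have "\<dots> = - ip n w h"
    using sum_Sym_transpose[OF assms(1,2), of "\<lambda>p. w p * h p"] by (simp add: ip_def sum_negf)
  finally show ?thesis .
qed

text \<open>The three inner products differ from the right-hand side by a multiple of the squared norm of
  the projection of \<open>g\<close> to the sign representation of the symmetric group on \<open>{a, b, c}\<close>.\<close>

lemma ip_dif_triangle:
  assumes abc: "a \<in> {1..n}" "b \<in> {1..n}" "c \<in> {1..n}" and ne: "a \<noteq> b" "b \<noteq> c" "c \<noteq> a"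
  shows "(sq n (dif a b g) + sq n (dif b c g) + sq n (dif c a g)) / 4
     \<le> ip n (dif a b g) (dif b c g) + ip n (dif b c g) (dif c a g) + ip n (dif c a g) (dif a b g)"
proof -
  define s t u where "s = transpose a b" and "t = transpose b c" and "u = transpose c a"
  have ss: "s \<circ> s = id" "t \<circ> t = id" "u \<circ> u = id" by (auto simp: s_def t_def u_def)
  have tu: "t \<circ> u = s \<circ> t" "u \<circ> s = s \<circ> t"
    using ne by (auto simp: s_def t_def u_def fun_eq_iff transpose_def)
  have su: "s \<circ> u = t \<circ> s" "u \<circ> t = t \<circ> s"
    using ne by (auto simp: s_def t_def u_def fun_eq_iff transpose_def)
  have sr: "s \<circ> (s \<circ> t) = t" "s \<circ> (t \<circ> s) = u" "t \<circ> (s \<circ> t) = u" "t \<circ> (t \<circ> s) = s"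
    "u \<circ> (s \<circ> t) = s" "u \<circ> (t \<circ> s) = t"
    using ne by (auto simp: s_def t_def u_def fun_eq_iff transpose_def)
  define k where "k x = ip n g (\<lambda>p. g (p \<circ> x))" for x
  \<comment> \<open>The alternating sum of the six translates of \<open>g\<close>. It satisfies
    \<open>sq n w = 6 * ip n w g\<close>, and the two sides of the claim differ by exactly a quarter
    of \<open>sq n w\<close>.\<close>
  define w where "w p = g p + g (p \<circ> (s \<circ> t)) + g (p \<circ> (t \<circ> s)) - g (p \<circ> s) - g (p \<circ> t) - g (p \<circ> u)" for p
  have ws: "w (p \<circ> s) = - w p" for p by (simp add: w_def comp_assoc ss su sr)
  have wt: "w (p \<circ> t) = - w p" for p by (simp add: w_def comp_assoc ss tu sr)
  have wu: "w (p \<circ> u) = - w p" for p by (simp add: w_def comp_assoc ss tu su sr)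
  have 1: "ip n w (\<lambda>p. h (p \<circ> s)) = - ip n w h" "ip n w (\<lambda>p. h (p \<circ> t)) = - ip n w h"
    "ip n w (\<lambda>p. h (p \<circ> u)) = - ip n w h" for h
    using ip_antisym[of a n b w h] ip_antisym[of b n c w h] ip_antisym[of c n a w h] ws wt wu abc
    by (simp_all add: s_def t_def u_def)
  have 2: "ip n w (\<lambda>p. g (p \<circ> (s \<circ> t))) = ip n w g"
    using 1(1)[of "\<lambda>p. g (p \<circ> t)"] 1(2)[of g] by (simp add: comp_assoc)
  have 3: "ip n w (\<lambda>p. g (p \<circ> (t \<circ> s))) = ip n w g"
    using 1(2)[of "\<lambda>p. g (p \<circ> s)"] 1(1)[of g] by (simp add: comp_assoc)
  have "sq n w = ip n w g + ip n w (\<lambda>p. g (p \<circ> (s \<circ> t))) + ip n w (\<lambda>p. g (p \<circ> (t \<circ> s)))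
      - ip n w (\<lambda>p. g (p \<circ> s)) - ip n w (\<lambda>p. g (p \<circ> t)) - ip n w (\<lambda>p. g (p \<circ> u))"
    unfolding sq_ip ip_def sum.distrib[symmetric] sum_subtractf[symmetric]
    by (intro sum.cong refl) (simp add: w_def algebra_simps)
  also have "\<dots> = 6 * ip n w g" by (simp add: 1 2 3)
  finally have "0 \<le> ip n w g" using sq_nonneg[of n w] by linarith
  also have "ip n w g = sq n g + k (s \<circ> t) + k (t \<circ> s) - k s - k t - k u"
    unfolding sq_ip k_def ip_def sum.distrib[symmetric] sum_subtractf[symmetric]
    by (intro sum.cong refl) (simp add: w_def algebra_simps)
  finally have pos: "0 \<le> sq n g + k (s \<circ> t) + k (t \<circ> s) - k s - k t - k u" .
  \<comment> \<open>The two 3-cycles are inverse to each other, and translation by a permutation is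
    adjoint to translation by its inverse.\<close>
  have kinv: "k (t \<circ> s) = k (s \<circ> t)"
  proof -
    have "k (t \<circ> s) = (\<Sum>p\<in>Sym n. g (p \<circ> t) * g (p \<circ> t \<circ> (t \<circ> s)))"
      unfolding k_def ip_def t_def by (rule sum_Sym_transpose[OF abc(2,3), symmetric])
    also have "\<dots> = (\<Sum>p\<in>Sym n. g (p \<circ> t) * g (p \<circ> s))"
      by (simp add: comp_assoc sr)
    also have "\<dots> = (\<Sum>p\<in>Sym n. g (p \<circ> s \<circ> t) * g (p \<circ> s \<circ> s))"
      unfolding s_def by (rule sum_Sym_transpose[OF abc(1,2), symmetric])
    also have "\<dots> = k (s \<circ> t)"
      by (simp add: comp_assoc ss k_def ip_def mult.commute)
    finally show ?thesis .
  qed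
  have e: "sq n (dif a b g) = 2 * sq n g - 2 * k s" "sq n (dif b c g) = 2 * sq n g - 2 * k t"
    "sq n (dif c a g) = 2 * sq n g - 2 * k u"
    using abc by (simp_all add: sq_dif k_def s_def t_def u_def)
  have e1: "ip n (dif a b g) (dif b c g) = sq n g - k s - k t + k (s \<circ> t)"
    using ip_dif_dif[OF abc(1,2), of g b c] by (simp add: k_def s_def t_def)
  have e2: "ip n (dif b c g) (dif c a g) = sq n g - k t - k u + k (s \<circ> t)"
    using ip_dif_dif[OF abc(2,3), of g c a] unfolding tu(1)[symmetric] by (simp add: k_def u_def t_def)
  have e3: "ip n (dif c a g) (dif a b g) = sq n g - k u - k s + k (s \<circ> t)"
    using ip_dif_dif[OF abc(3,1), of g a b] unfolding tu(2)[symmetric] by (simp add: k_def u_def s_def)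
  show ?thesis unfolding e e1 e2 e3 using pos unfolding kinv by simp
qed

lemma sum_split_pair:
  fixes F :: "'a \<Rightarrow> 'a \<Rightarrow> real"
  assumes "finite X" "a \<in> X" "b \<in> X" "a \<noteq> b"
  shows "(\<Sum>c\<in>X. \<Sum>d\<in>X. F c d) = (\<Sum>c\<in>X - {a,b}. \<Sum>d\<in>X - {a,b}. F c d)
    + (\<Sum>c\<in>X - {a,b}. F a c + F c a + F b c + F c b) + (F a a + F a b + F b a + F b b)"
proof -
  have X: "X = insert a (insert b (X - {a,b}))" using assms by auto
  have 1: "(\<Sum>c\<in>X. H c) = H a + H b + (\<Sum>c\<in>X - {a,b}. H c)" for H :: "'a \<Rightarrow> real"
    by (subst X) (use assms in simp)
  show ?thesis by (simp add: 1 sum.distrib)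
qed

text \<open>The contribution of the disjoint transpositions to the squared norm of the
  Laplacian.\<close>

definition cross :: "nat \<Rightarrow> nat set \<Rightarrow> ((nat \<Rightarrow> nat) \<Rightarrow> real) \<Rightarrow> real" where
  "cross n X g = (\<Sum>a\<in>X. \<Sum>b\<in>X. \<Sum>c\<in>X - {a,b}. \<Sum>d\<in>X - {a,b}. ip n (dif a b g) (dif c d g))"

lemma ip_dif_same [simp]: "ip n (dif a a g) h = 0" "ip n h (dif a a g) = 0"
  by (simp_all add: ip_def)

lemma sum_rotate3: "(\<Sum>a\<in>X. \<Sum>b\<in>X. \<Sum>c\<in>X. V b c a) = (\<Sum>a\<in>X. \<Sum>b\<in>X. \<Sum>c\<in>X. V a b c :: real)"
  by (subst sum.swap, rule sum.cong[OF refl], subst sum.swap, rule refl)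

lemma sum_if_distinct:
  assumes "finite X" "\<And>b c. V b b c = (0::real)"
  shows "(\<Sum>a\<in>X. \<Sum>b\<in>X. \<Sum>c\<in>X - {a,b}. V a b c) =
    (\<Sum>a\<in>X. \<Sum>b\<in>X. \<Sum>c\<in>X. if a \<noteq> b \<and> b \<noteq> c \<and> c \<noteq> a then V a b c else 0)"
proof (rule sum.cong[OF refl], rule sum.cong[OF refl])
  fix a b assume "a \<in> X" "b \<in> X"
  show "(\<Sum>c\<in>X - {a,b}. V a b c) = (\<Sum>c\<in>X. if a \<noteq> b \<and> b \<noteq> c \<and> c \<noteq> a then V a b c else 0)"
  proof (cases "a = b")
    case True then show ?thesis using assms by simp
  next
    case False then show ?thesis using assms(1) by (intro sum.mono_neutral_cong_left) auto
  qed
qed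

text \<open>In the expanded square two transpositions coincide, share one point or are disjoint.
  Coinciding ones give \<open>2 * ener\<close>; those sharing a point, grouped into triangles, give
  at least \<open>(card X - 2) * ener\<close>.\<close>

lemma sq_lap_ge:
  assumes X: "X \<subseteq> {1..n}"
  shows "real (card X) * ener n X g + cross n X g \<le> sq n (lap X g)"
proof -
  have fin: "finite X" using X finite_subset by blast
  define J where "J a b c d = ip n (dif a b g) (dif c d g)" for a b c d
  have Jsym: "J a b c d = J c d a b" "J a b c d = J b a c d" "J a b c d = J a b d c" for a b c d
    by (auto simp: J_def ip_commute dif_commute)
  have J0: "J a a c d = 0" "J c d a a = 0" for a c d by (simp_all add: J_def)
  define E where "E a b = sq n (dif a b g)" for a b
  have E: "J a b a b = E a b" "E a a = 0" for a b by (simp_all add: J_def E_def sq_ip)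
  have "sq n (lap X g) = (\<Sum>a\<in>X. \<Sum>b\<in>X. ip n (lap X g) (dif a b g))"
    unfolding sq_ip by (subst (2) lap_def[abs_def]) (simp add: ip_sum_right)
  also have "\<dots> = (\<Sum>a\<in>X. \<Sum>b\<in>X. \<Sum>c\<in>X. \<Sum>d\<in>X. J a b c d)"
  proof (intro sum.cong refl)
    fix a b
    have "ip n (lap X g) (dif a b g) = ip n (dif a b g) (lap X g)" by (rule ip_commute)
    also have "\<dots> = (\<Sum>c\<in>X. \<Sum>d\<in>X. J a b c d)"
      unfolding lap_def[abs_def] by (simp add: ip_sum_right J_def)
    finally show "ip n (lap X g) (dif a b g) = (\<Sum>c\<in>X. \<Sum>d\<in>X. J a b c d)" .
  qed
  also have "\<dots> = (\<Sum>a\<in>X. \<Sum>b\<in>X. (\<Sum>c\<in>X - {a,b}. \<Sum>d\<in>X - {a,b}. J a b c d)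
      + (\<Sum>c\<in>X - {a,b}. 2 * J a b b c + 2 * J c a a b) + 2 * E a b)"
  proof (intro sum.cong refl)
    fix a b assume ab: "a \<in> X" "b \<in> X"
    show "(\<Sum>c\<in>X. \<Sum>d\<in>X. J a b c d) = (\<Sum>c\<in>X - {a,b}. \<Sum>d\<in>X - {a,b}. J a b c d)
      + (\<Sum>c\<in>X - {a,b}. 2 * J a b b c + 2 * J c a a b) + 2 * E a b"
    proof (cases "a = b")
      case True then show ?thesis by (simp add: J0 E)
    next
      case False
      have "J a b a c + J a b c a + J a b b c + J a b c b = 2 * J a b b c + 2 * J c a a b" for c
        using Jsym(1)[of a b c a] Jsym(3)[of a b a c] Jsym(3)[of a b b c] by linarith
      then have "(\<Sum>c\<in>X - {a,b}. J a b a c + J a b c a + J a b b c + J a b c b) =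
          (\<Sum>c\<in>X - {a,b}. 2 * J a b b c + 2 * J c a a b)" by (rule sum.cong[OF refl])
      moreover have "J a b b a = E a b" using Jsym(3)[of a b b a] E(1) by simp
      ultimately show ?thesis
        using sum_split_pair[OF fin ab False, of "J a b"] by (simp add: J0 E)
    qed
  qed
  also have "\<dots> = cross n X g + 2 * ener n X g
      + 2 * (\<Sum>a\<in>X. \<Sum>b\<in>X. \<Sum>c\<in>X - {a,b}. J a b b c) + 2 * (\<Sum>a\<in>X. \<Sum>b\<in>X. \<Sum>c\<in>X - {a,b}. J c a a b)"
    by (simp add: sum.distrib sum_distrib_left cross_def ener_def J_def E_def)
  finally have main: "sq n (lap X g) = cross n X g + 2 * ener n X g
      + 2 * (\<Sum>a\<in>X. \<Sum>b\<in>X. \<Sum>c\<in>X - {a,b}. J a b b c) + 2 * (\<Sum>a\<in>X. \<Sum>b\<in>X. \<Sum>c\<in>X - {a,b}. J c a a b)" .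
  define V where "V a b c = (if a \<noteq> b \<and> b \<noteq> c \<and> c \<noteq> a then J a b b c else 0)" for a b c
  define Q where "Q a b c = (if a \<noteq> b \<and> b \<noteq> c \<and> c \<noteq> a then E a b / 4 else 0)" for a b c
  let ?S = "\<lambda>V. \<Sum>a\<in>X. \<Sum>b\<in>X. \<Sum>c\<in>X. V a b c :: real"
  have rot: "?S (\<lambda>a b c. H b c a) = ?S H" "?S (\<lambda>a b c. H c a b) = ?S H" for H
    using sum_rotate3[where V=H] sum_rotate3[where V="\<lambda>a b c. H b c a"] by simp_all
  have S1: "(\<Sum>a\<in>X. \<Sum>b\<in>X. \<Sum>c\<in>X - {a,b}. J a b b c) = ?S V"
    unfolding V_def by (rule sum_if_distinct[OF fin]) (simp add: J0)
  have "(\<Sum>a\<in>X. \<Sum>b\<in>X. \<Sum>c\<in>X - {a,b}. J c a a b) = ?S (\<lambda>a b c. V c a b)"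
    by (subst sum_if_distinct[OF fin]) (auto simp: J0 V_def intro!: sum.cong)
  then have S2: "(\<Sum>a\<in>X. \<Sum>b\<in>X. \<Sum>c\<in>X - {a,b}. J c a a b) = ?S V" by (simp add: rot(2)[of V])
  \<comment> \<open>A single inner product has no lower bound of this kind; only the sum over the
    three rotations of a triple is covered by \<open>ip_dif_triangle\<close>.\<close>
  have "?S (\<lambda>a b c. Q a b c + Q b c a + Q c a b) \<le> ?S (\<lambda>a b c. V a b c + V b c a + V c a b)"
  proof (intro sum_mono)
    fix a b c assume "a \<in> X" "b \<in> X" "c \<in> X"
    then have abc: "a \<in> {1..n}" "b \<in> {1..n}" "c \<in> {1..n}" using X by auto
    show "Q a b c + Q b c a + Q c a b \<le> V a b c + V b c a + V c a b"
    proof (cases "a \<noteq> b \<and> b \<noteq> c \<and> c \<noteq> a")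
      case True
      then have "(E a b + E b c + E c a) / 4 \<le> J a b b c + J b c c a + J c a a b"
        using ip_dif_triangle[OF abc, of g] by (simp add: E_def J_def)
      then show ?thesis using True by (simp add: Q_def V_def)
    next
      case False then show ?thesis by (auto simp: Q_def V_def)
    qed
  qed
  then have "3 * ?S Q \<le> 3 * ?S V"
    using rot[of Q] rot[of V] by (simp add: sum.distrib)
  moreover have "?S Q = (real (card X) - 2) / 4 * ener n X g"
  proof -
    have "?S Q = (\<Sum>a\<in>X. \<Sum>b\<in>X. \<Sum>c\<in>X - {a,b}. E a b / 4)"
      unfolding Q_def by (rule sum_if_distinct[OF fin, symmetric]) (simp add: E)
    also have "\<dots> = (\<Sum>a\<in>X. \<Sum>b\<in>X. (real (card X) - 2) / 4 * E a b)"
    proof (intro sum.cong refl)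
      fix a b assume ab: "a \<in> X" "b \<in> X"
      show "(\<Sum>c\<in>X - {a,b}. E a b / 4) = (real (card X) - 2) / 4 * E a b"
      proof (cases "a = b")
        case True then show ?thesis by (simp add: E)
      next
        case False
        then have "card {a,b} \<le> card X" using ab fin by (intro card_mono) auto
        then have "real (card (X - {a,b})) = real (card X) - 2"
          using False ab fin by (subst card_Diff_subset) auto
        then show ?thesis by simp
      qed
    qed
    finally show ?thesis by (simp add: ener_def E_def sum_distrib_left)
  qed
  ultimately have "(real (card X) - 2) / 4 * ener n X g \<le> ?S V" by linarith
  then show ?thesis unfolding main S1 S2 by (simp add: field_simps)
qed

lemma dif_dif_commute:
  assumes "a \<noteq> c" "a \<noteq> d" "b \<noteq> c" "b \<noteq> d"
  shows "dif a b (dif c d g) = dif c d (dif a b g)"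
proof -
  have "transpose a b \<circ> transpose c d = transpose c d \<circ> transpose a b"
    using assms by (auto simp: fun_eq_iff transpose_def)
  then show ?thesis by (intro ext) (simp add: dif_def comp_assoc)
qed

text \<open>Disjoint transpositions commute, so \<open>ip_dif_right\<close> can be used once for
  each of them and leaves a square. In particular \<open>cross\<close> is nonnegative.\<close>

lemma ip_dif_disjoint:
  assumes "a \<in> {1..n}" "b \<in> {1..n}" "c \<in> {1..n}" "d \<in> {1..n}" "a \<noteq> c" "a \<noteq> d" "b \<noteq> c" "b \<noteq> d"
  shows "ip n (dif a b g) (dif c d g) = sq n (dif c d (dif a b g)) / 4"
proof -
  have "ip n (dif a b g) (dif c d g) = ip n (dif c d (dif a b g)) (dif c d g) / 2"
    using assms by (intro ip_dif_right) auto
  also have "ip n (dif c d (dif a b g)) (dif c d g) = ip n (dif c d g) (dif a b (dif c d g))"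
    using assms by (simp add: ip_commute dif_dif_commute)
  also have "\<dots> = ip n (dif a b (dif c d g)) (dif a b (dif c d g)) / 2"
    using assms by (intro ip_dif_right) auto
  finally show ?thesis using assms by (simp add: sq_ip dif_dif_commute)
qed

lemma cross_ener:
  assumes "X \<subseteq> {1..n}"
  shows "cross n X g = (\<Sum>a\<in>X. \<Sum>b\<in>X. ener n (X - {a,b}) (dif a b g)) / 4"
  unfolding cross_def ener_def sum_divide_distrib
  using assms by (intro sum.cong refl ip_dif_disjoint) auto

lemma sq_lap_ge_ener:
  assumes "X \<subseteq> {1..n}"
  shows "real (card X) * ener n X g \<le> sq n (lap X g)"
  using sq_lap_ge[OF assms, of g] cross_ener[OF assms, of g]
  by (smt (verit) ener_nonneg sum_nonneg divide_nonneg_nonneg)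

text \<open>The spectral gap of the transposition walk, transferred from the lower bound on the square of
  the Laplacian by solving the Poisson equation.\<close>

lemma spectral_gap:
  assumes X: "X \<subseteq> {1..n}"
  shows "4 * real (card X) * sq n (\<lambda>p. g p - av X g p) \<le> ener n X g"
proof -
  have fin: "finite X" using X finite_subset by blast
  define h where "h p = g p - av X g p" for p
  have "av X h p = 0" for p
    unfolding h_def[abs_def] av_diff by (simp add: av_invariant[OF fin, of "av X g"] av_permute)
  then obtain G where G: "\<And>p. p \<in> Sym n \<Longrightarrow> lap X G p = h p" using poisson[OF X, of h] by blast
  define k where "k = real (card X)"
  have k: "k \<ge> 0" by (simp add: k_def)
  have "sq n h = sq n (lap X G)" by (rule sq_cong) (simp add: G)
  then have 1: "k * ener n X G \<le> sq n h" using sq_lap_ge_ener[OF X, of G] by (simp add: k_def)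
  have 2: "ip n h (lap X G) = sq n h" unfolding sq_ip by (rule ip_cong) (simp_all add: G)
  \<comment> \<open>After the bound \<open>k * ener n X G \<le> sq n h\<close>, the right-hand side
    is quadratic in the multiple of \<open>G\<close>, and \<open>2 * k\<close> is its
    minimiser.\<close>
  have "0 \<le> ener n X (\<lambda>p. h p - 2 * k * G p)" by (rule ener_nonneg)
  also have "\<dots> = ener n X h - 8 * k * sq n h + 4 * k * (k * ener n X G)"
    unfolding ener_diff_scale[OF X] 2 by (simp add: power2_eq_square)
  also have "\<dots> \<le> ener n X h - 8 * k * sq n h + 4 * k * sq n h"
    using mult_left_mono[OF 1, of "4 * k"] k by simp
  finally have "4 * k * sq n h \<le> ener n X h" by simp
  also have "ener n X h = ener n X g"
    unfolding ener_def h_def[abs_def] using dif_diff_scale[of _ _ g 1 "av X g"]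
    by (intro sum.cong refl sq_cong) (simp add: dif_av)
  finally show ?thesis by (simp add: k_def h_def[abs_def])
qed

definition psi :: "nat \<Rightarrow> ((nat \<Rightarrow> nat) \<Rightarrow> real) \<Rightarrow> nat \<Rightarrow> nat \<Rightarrow> (nat \<Rightarrow> nat) \<Rightarrow> real" where
  "psi n g a b = av ({1..n} - {a,b}) (dif a b g)"

lemma psi_same [simp]: "psi n g a a p = 0"
  by (simp add: psi_def av_def)

text \<open>Instead of dropping \<open>cross\<close> as nonnegative, each of its terms is bounded by
  the gap on the other \<open>n - 2\<close> points, which measures the distance of
  \<open>dif a b g\<close> from its average \<open>psi n g a b\<close>.\<close>

lemma sq_lap_ge_psi:
  assumes "n \<ge> 2"
  shows "(2 * real n - 2) * ener n {1..n} g - (real n - 2) * (\<Sum>a\<in>{1..n}. \<Sum>b\<in>{1..n}. sq n (psi n g a b))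
     \<le> sq n (lap {1..n} g)"
proof -
  let ?X = "{1..n}"
  have "(\<Sum>a\<in>?X. \<Sum>b\<in>?X. (real n - 2) * (sq n (dif a b g) - sq n (psi n g a b))) \<le>
     (\<Sum>a\<in>?X. \<Sum>b\<in>?X. ener n (?X - {a,b}) (dif a b g) / 4)"
  proof (intro sum_mono)
    fix a b assume ab: "a \<in> ?X" "b \<in> ?X"
    show "(real n - 2) * (sq n (dif a b g) - sq n (psi n g a b)) \<le> ener n (?X - {a,b}) (dif a b g) / 4"
    proof (cases "a = b")
      case True then show ?thesis by (simp add: sq_def ener_nonneg)
    next
      case False
      have "real (card (?X - {a,b})) = real n - 2"
        using False ab assms by (subst card_Diff_subset) auto
      then have "4 * (real n - 2) * (sq n (dif a b g) - sq n (psi n g a b)) \<le> ener n (?X - {a,b}) (dif a b g)"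
        using spectral_gap[of "?X - {a,b}" n "dif a b g"]
        by (simp only: psi_def sq_minus_av[of "?X - {a,b}" n "dif a b g"] Diff_subset)
      then show ?thesis unfolding mult.assoc by linarith
    qed
  qed
  also have "\<dots> = cross n ?X g" by (simp add: cross_ener sum_divide_distrib)
  finally have "(real n - 2) * (ener n ?X g - (\<Sum>a\<in>?X. \<Sum>b\<in>?X. sq n (psi n g a b))) \<le> cross n ?X g"
    by (simp add: sum_subtractf ener_def flip: sum_distrib_left)
  then show ?thesis using sq_lap_ge[of ?X n g] by (simp add: algebra_simps)
qed

subsection \<open>Small boundary forces local differences\<close>

declare One_nat_def [simp del]

section \<open>Commutation of the Laplacian with translations and averages\<close>

lemma permutes_comp_transpose:
  assumes "p permutes S"
  shows "p \<circ> transpose a b = transpose (p a) (p b) \<circ> p"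
  using permutes_inj[OF assms] by (auto simp: fun_eq_iff transpose_def inj_eq)

text \<open>A swap of positions is a swap of values, and \<open>p\<close> carries the pairs of
  positions bijectively to the pairs of values. Swaps on the left commute with right translations,
  which gives \<open>lap_comp\<close>.\<close>

lemma lap_left:
  assumes "p \<in> Sym n"
  shows "lap {1..n} g p = (\<Sum>x\<in>{1..n}. \<Sum>y\<in>{1..n}. g p - g (transpose x y \<circ> p))"
proof -
  have p: "p permutes {1..n}" using assms by (simp add: Sym_def)
  have bij: "bij_betw p {1..n} {1..n}" by (rule permutes_imp_bij[OF p])
  have "lap {1..n} g p = (\<Sum>a\<in>{1..n}. \<Sum>b\<in>{1..n}. g p - g (transpose (p a) (p b) \<circ> p))"
    by (simp add: lap_def dif_def permutes_comp_transpose[OF p])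
  also have "\<dots> = (\<Sum>a\<in>{1..n}. \<Sum>y\<in>{1..n}. g p - g (transpose (p a) y \<circ> p))"
    by (intro sum.cong refl sum.reindex_bij_betw[OF bij])
  also have "\<dots> = (\<Sum>x\<in>{1..n}. \<Sum>y\<in>{1..n}. g p - g (transpose x y \<circ> p))"
    by (rule sum.reindex_bij_betw[OF bij])
  finally show ?thesis .
qed

lemma lap_comp:
  assumes "p \<in> Sym n" "s \<in> Sym n"
  shows "lap {1..n} (\<lambda>p. g (p \<circ> s)) p = lap {1..n} g (p \<circ> s)"
  by (simp only: lap_left[OF assms(1)] lap_left[OF Sym_comp[OF assms]] comp_assoc)

lemma lap_dif:
  assumes "p \<in> Sym n" "a \<in> {1..n}" "b \<in> {1..n}"
  shows "lap {1..n} (dif a b g) p = dif a b (lap {1..n} g) p"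
proof -
  have "transpose a b \<in> Sym n" using assms by (simp add: Sym_def permutes_swap_id)
  then show ?thesis
    using lap_diff_scale[of "{1..n}" g 1 "\<lambda>p. g (p \<circ> transpose a b)" p] lap_comp[OF assms(1)]
    by (simp add: dif_def[abs_def])
qed

lemma dif_div: "dif a b (\<lambda>p. g p / k) p = dif a b g p / k"
  by (simp add: dif_def diff_divide_distrib)

lemma dif_sum: "dif a b (\<lambda>p. \<Sum>i\<in>I. g i p) p = (\<Sum>i\<in>I. dif a b (g i) p)"
  by (simp add: dif_def sum_subtractf)

lemma lap_div: "lap X (\<lambda>p. g p / k) p = lap X g p / k"
  by (simp add: lap_def dif_div sum_divide_distrib)

lemma lap_sum: "lap X (\<lambda>p. \<Sum>i\<in>I. g i p) p = (\<Sum>i\<in>I. lap X (g i) p)"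
  by (simp add: lap_def dif_sum sum.swap[of _ _ I])

lemma lap_av:
  assumes "p \<in> Sym n" "Y \<subseteq> {1..n}"
  shows "lap {1..n} (av Y g) p = av Y (lap {1..n} g) p"
proof -
  have "lap {1..n} (\<lambda>p. g (p \<circ> s)) p = lap {1..n} g (p \<circ> s)" if "s permutes Y" for s
    using assms that by (intro lap_comp) (auto simp: Sym_def intro: permutes_subset)
  then show ?thesis by (simp add: av_def[abs_def] lap_div lap_sum)
qed

lemma av_av:
  assumes "Y \<subseteq> X" "finite X"
  shows "av X (av Y g) p = av X g p"
proof -
  have fin: "finite Y" using assms finite_subset by blast
  have "av X (av Y g) p = av X (\<lambda>p. \<Sum>s | s permutes Y. g (p \<circ> s)) p / fact (card Y)"
    by (simp add: av_def sum_divide_distrib mult.commute)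
  also have "\<dots> = (\<Sum>s | s permutes Y. av X g p) / fact (card Y)"
    unfolding av_sum using assms(1) by (intro arg_cong2[where f="(/)"] sum.cong refl av_comp) (auto intro: permutes_subset)
  also have "\<dots> = av X g p" using card_permutations[OF refl fin] by simp
  finally show ?thesis .
qed

lemma av_cong:
  assumes "p \<in> Sym n" "X \<subseteq> {1..n}" "\<And>p. p \<in> Sym n \<Longrightarrow> g p = h p"
  shows "av X g p = av X h p"
proof -
  have "g (p \<circ> s) = h (p \<circ> s)" if "s permutes X" for s
    using assms(3)[OF Sym_comp_permutes[OF assms(1,2) that]] .
  then show ?thesis by (simp add: av_def)
qed

lemma dif_cong:
  assumes "p \<in> Sym n" "a \<in> {1..n}" "b \<in> {1..n}" "\<And>p. p \<in> Sym n \<Longrightarrow> g p = h p"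
  shows "dif a b g p = dif a b h p"
  unfolding dif_def using assms Sym_transpose[OF assms(1-3)] by simp

lemma psi_affine:
  assumes p: "p \<in> Sym n" and ab: "a \<in> {1..n}" "b \<in> {1..n}"
    and g: "\<And>p. p \<in> Sym n \<Longrightarrow> g p = k * (h p - c)"
  shows "psi n g a b p = k * psi n h a b p"
proof -
  have "psi n g a b p = av ({1..n} - {a,b}) (\<lambda>p. k * dif a b h p) p"
    unfolding psi_def
  proof (rule av_cong[OF p])
    fix q assume q: "q \<in> Sym n"
    have "dif a b g q = dif a b (\<lambda>p. k * (h p - c)) q" by (rule dif_cong[OF q ab g])
    then show "dif a b g q = k * dif a b h q" by (simp add: dif_def algebra_simps)
  qed auto
  then show ?thesis by (simp add: av_def psi_def sum_distrib_left)
qed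

lemma lap_psi:
  assumes "p \<in> Sym n" "a \<in> {1..n}" "b \<in> {1..n}"
  shows "lap {1..n} (psi n g a b) p = psi n (lap {1..n} g) a b p"
proof -
  have "lap {1..n} (psi n g a b) p = av ({1..n} - {a,b}) (lap {1..n} (dif a b g)) p"
    unfolding psi_def by (rule lap_av[OF assms(1)]) auto
  also have "\<dots> = psi n (lap {1..n} g) a b p"
    unfolding psi_def by (rule av_cong[OF assms(1)]) (use assms in \<open>auto simp: lap_dif simp del: One_nat_def\<close>)
  finally show ?thesis .
qed

lemma sq_scale: "sq n (\<lambda>p. k * g p) = k\<^sup>2 * sq n g"
  by (simp add: sq_def power_mult_distrib sum_distrib_left)

text \<open>\<open>psi n G a b\<close> has mean zero, and on such functions the Laplacian enlarges
  the norm at least \<open>2 * n\<close> times; it maps this one to \<open>2 * n\<close> times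
  \<open>psi n f a b\<close>.\<close>

lemma sq_psi_poisson_le:
  assumes G: "\<And>p. p \<in> Sym n \<Longrightarrow> lap {1..n} G p = 2 * real n * (f p - c)"
    and ab: "a \<in> {1..n}" "b \<in> {1..n}"
  shows "sq n (psi n G a b) \<le> sq n (psi n f a b)"
proof -
  have n: "n > 0" using ab by auto
  have "real n * (4 * real n * sq n (psi n G a b)) = real n * (4 * real (card {1..n}) * sq n (\<lambda>p. psi n G a b p - av {1..n} (psi n G a b) p))"
    using ab by (simp add: psi_def av_av av_dif del: One_nat_def)
  also have "\<dots> \<le> real n * ener n {1..n} (psi n G a b)"
    by (intro mult_left_mono spectral_gap) auto
  also have "\<dots> \<le> sq n (lap {1..n} (psi n G a b))"
    using sq_lap_ge_ener[of "{1..n}" n "psi n G a b"] by simp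
  also have "\<dots> = sq n (\<lambda>p. 2 * real n * psi n f a b p)"
    by (rule sq_cong) (simp only: lap_psi[OF _ ab] psi_affine[OF _ ab G])
  also have "\<dots> = real n * (4 * real n * sq n (psi n f a b))"
    by (simp add: sq_scale power2_eq_square)
  finally show ?thesis using n by simp
qed

lemma av_full:
  assumes "p \<in> Sym n"
  shows "av {1..n} g p = (\<Sum>p\<in>Sym n. g p) / fact n"
  using setum_permutations_compose_left[of p "{1..n}" g] assms by (simp add: av_def Sym_def)

text \<open>By the gap, \<open>4 * n * fact n * c * (1 - c)\<close> is the least energy at this
  variance, and \<open>\<eta>\<close> measures the excess. In these units the energy of
  \<open>G\<close> may fall short by \<open>\<eta>\<close> and the sum for its \<open>psi\<close> by
  \<open>3 * \<eta>\<close>; with the excess of \<open>f\<close> itself this makes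
  \<open>4 * \<eta>\<close>, whence 16.\<close>

lemma sum_sq_dif_minus_psi_le:
  assumes n: "n \<ge> 4" and f01: "\<And>p. p \<in> Sym n \<Longrightarrow> f p = 0 \<or> f p = 1"
    and mean: "(\<Sum>p\<in>Sym n. f p) = c * fact n"
    and en: "ener n {1..n} f \<le> 4 * real n * fact n * (c * (1 - c) + \<eta>)"
    and \<eta>: "\<eta> \<ge> 0"
  shows "(\<Sum>a\<in>{1..n}. \<Sum>b\<in>{1..n}. sq n (\<lambda>p. dif a b f p - psi n f a b p)) \<le> 16 * real n * fact n * \<eta>"
proof -
  let ?X = "{1..n}"
  define q where "q = c * (1 - c)"
  define N where "N = (fact n :: real)"
  define F where "F p = f p - c" for p
  define PG where "PG g = (\<Sum>a\<in>?X. \<Sum>b\<in>?X. sq n (psi n g a b))" for g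
  have avF: "av {1..n} (\<lambda>p. 2 * real n * F p) p = 0" if "p \<in> Sym n" for p
    using mean by (simp only: av_full[OF that]) (simp add: F_def sum_subtractf card_Sym flip: sum_distrib_left)
  have "\<exists>G. \<forall>p\<in>Sym n. lap {1..n} G p = 2 * real n * F p"
    by (rule poisson[OF order_refl avF], assumption, blast)
  then obtain G where G0: "\<And>p. p \<in> Sym n \<Longrightarrow> lap {1..n} G p = 2 * real n * F p" by metis
  have G: "lap {1..n} G p = 2 * real n * (f p - c)" if "p \<in> Sym n" for p
    using G0[OF that] unfolding F_def .
  have sqF: "sq n F = q * N"
  proof -
    have "(F p)\<^sup>2 = (1 - 2 * c) * f p + c\<^sup>2" if "p \<in> Sym n" for p
      using f01[OF that] by (auto simp: F_def power2_eq_square algebra_simps)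
    then have "sq n F = (\<Sum>p\<in>Sym n. (1 - 2 * c) * f p + c\<^sup>2)" by (simp add: sq_def)
    also have "\<dots> = (1 - 2 * c) * (c * N) + N * c\<^sup>2"
      using mean by (simp add: sum.distrib card_Sym N_def flip: sum_distrib_left)
    finally show ?thesis by (simp add: q_def power2_eq_square algebra_simps)
  qed
  have "ip n F (lap ?X G) = ip n F (\<lambda>p. 2 * real n * F p)" by (rule ip_cong) (simp_all add: G F_def)
  also have "\<dots> = 2 * real n * sq n F" by (simp add: ip_def sq_def power2_eq_square sum_distrib_left mult_ac)
  finally have ipF: "ip n F (lap ?X G) = 2 * real n * (q * N)" by (simp add: sqF)
  have "sq n (lap ?X G) = sq n (\<lambda>p. 2 * real n * F p)" by (rule sq_cong) (simp add: G F_def)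
  then have sqlap: "sq n (lap ?X G) = 4 * (real n)\<^sup>2 * (q * N)" by (simp add: sq_scale sqF power_mult_distrib)
  have "dif a b F = dif a b f" for a b by (rule ext) (simp add: dif_def F_def)
  then have enF: "ener n ?X F = ener n ?X f" by (simp add: ener_def)
  \<comment> \<open>Cauchy-Schwarz for the energy form, written as the nonnegative energy of
    \<open>F - G\<close>. Equality would make \<open>F\<close> an eigenfunction for the least
    positive eigenvalue.\<close>
  have "0 \<le> ener n ?X F - 4 * ip n F (lap ?X G) + ener n ?X G"
    using ener_nonneg[of n ?X "\<lambda>p. F p - 1 * G p"] ener_diff_scale[of ?X n F 1 G] by simp
  then have "ener n ?X G \<ge> 8 * (real n * (q * N)) - ener n ?X f"
    unfolding enF ipF by linarith
  moreover have "ener n ?X f \<le> 4 * real n * N * (q + \<eta>)" using en by (simp add: q_def N_def)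
  ultimately have enG: "4 * real n * N * (q - \<eta>) \<le> ener n ?X G" by (simp add: algebra_simps)
  have "(real n - 2) * (4 * real n * N * (q - 3 * \<eta>)) \<le> (2 * real n - 2) * (4 * real n * N * (q - \<eta>)) - 4 * (real n)\<^sup>2 * (q * N)"
  proof -
    \<comment> \<open>The coefficients of \<open>q\<close> cancel; the loss
      \<open>3 * \<eta>\<close> leaves a surplus proportional to \<open>n - 4\<close>.\<close>
    have "(2 * real n - 2) * (4 * real n * N * (q - \<eta>)) - 4 * (real n)\<^sup>2 * (q * N) - (real n - 2) * (4 * real n * N * (q - 3 * \<eta>))
        = (4 * real n * N * \<eta>) * (real n - 4)"
      by (simp add: power2_eq_square algebra_simps)
    also have "\<dots> \<ge> 0" using n \<eta> by (simp add: N_def)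
    finally show ?thesis by linarith
  qed
  also have "\<dots> \<le> (2 * real n - 2) * ener n ?X G - 4 * (real n)\<^sup>2 * (q * N)"
    using n enG by (intro diff_right_mono mult_left_mono) auto
  also have "\<dots> \<le> (real n - 2) * PG G"
    using sq_lap_ge_psi[of n G] n unfolding sqlap PG_def[symmetric] by linarith
  finally have "4 * real n * N * (q - 3 * \<eta>) \<le> PG G"
    by (rule mult_left_le_imp_le) (use n in simp)
  also have "PG G \<le> PG f"
    unfolding PG_def by (intro sum_mono sq_psi_poisson_le[OF G])
  finally have PGf: "4 * real n * N * (q - 3 * \<eta>) \<le> PG f" .
  have "(\<Sum>a\<in>?X. \<Sum>b\<in>?X. sq n (\<lambda>p. dif a b f p - psi n f a b p)) = ener n ?X f - PG f"
    unfolding psi_def PG_def ener_def by (simp add: sq_minus_av sum_subtractf)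
  also have "\<dots> \<le> 16 * real n * N * \<eta>"
    using PGf en unfolding N_def[symmetric] q_def[symmetric] by (simp add: algebra_simps)
  finally show ?thesis by (simp add: N_def)
qed

section \<open>The energy of an indicator and the edge boundary\<close>

lemma transpose_less_inject:
  fixes a b c d :: nat
  assumes "transpose a b = transpose c d" "a < b" "c < d"
  shows "a = c \<and> b = d"
proof -
  have "{x. transpose i j x \<noteq> x} = {i, j}" if "i < j" for i j :: nat
    using that by (auto simp: transpose_def)
  then have "{a, b} = {c, d}" using assms by metis
  then show ?thesis using assms by (auto simp: doubleton_eq_iff)
qed

text \<open>An edge leaving \<open>A\<close> determines the swapped pair of positions; its two
  orders account for the factor 2.\<close>

lemma card_inner_boundary_le:
  assumes A: "A \<subseteq> Sym n"
  shows "card {(p, a, b). p \<in> A \<and> a \<in> {1..n} \<and> b \<in> {1..n} \<and> p \<circ> transpose a b \<notin> A} \<le> 2 * card (edge_boundary n A)"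
proof -
  let ?W = "{(p, a, b). p \<in> A \<and> a \<in> {1..n} \<and> b \<in> {1..n} \<and> p \<circ> transpose a b \<notin> A}"
  define W1 where "W1 = {(p, a, b). p \<in> A \<and> a \<in> {1..n} \<and> b \<in> {1..n} \<and> p \<circ> transpose a b \<notin> A \<and> a < b}"
  define sw where "sw = (\<lambda>(p::nat \<Rightarrow> nat, a::nat, b::nat). (p, b, a))"
  have finA: "finite A" using A finite_Sym by (rule finite_subset)
  have "W1 \<subseteq> A \<times> {1..n} \<times> {1..n}" by (auto simp: W1_def)
  then have finW1: "finite W1" by (rule finite_subset) (use finA in simp)
  have finE: "finite (edge_boundary n A)"
    by (rule finite_subset[of _ "Sym n \<times> Sym n"]) (use A in \<open>auto simp: edge_boundary_def\<close>)
  have W: "?W \<subseteq> W1 \<union> sw ` W1"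
  proof
    fix z assume "z \<in> ?W"
    then obtain p a b where z: "z = (p, a, b)" and
      *: "p \<in> A" "a \<in> {1..n}" "b \<in> {1..n}" "p \<circ> transpose a b \<notin> A" by blast
    have "a \<noteq> b" using * by auto
    then consider "a < b" | "b < a" by linarith
    then show "z \<in> W1 \<union> sw ` W1"
    proof cases
      case 1 then show ?thesis using * by (simp add: W1_def z)
    next
      case 2
      then have "(p, b, a) \<in> W1" using * transpose_commute[of a b] unfolding W1_def by simp
      then have "sw (p, b, a) \<in> sw ` W1" by (rule imageI)
      then show ?thesis by (simp add: sw_def z)
    qed
  qed
  have "card W1 \<le> card (edge_boundary n A)"
  proof (rule card_inj_on_le[of "\<lambda>(p, a, b). (p, p \<circ> transpose a b)"])
    show "inj_on (\<lambda>(p, a, b). (p, p \<circ> transpose a b)) W1"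
    proof (rule inj_onI)
      fix z z' assume zz: "z \<in> W1" "z' \<in> W1" and eq: "(\<lambda>(p, a, b). (p, p \<circ> transpose a b)) z = (\<lambda>(p, a, b). (p, p \<circ> transpose a b)) z'"
      obtain p a b q c d where z: "z = (p, a, b)" "z' = (q, c, d)" by (metis prod.exhaust)
      have "p = q" and 2: "p \<circ> transpose a b = p \<circ> transpose c d" using eq by (auto simp: z)
      have "inj p" using zz A by (auto simp: W1_def Sym_def permutes_inj z)
      then have "transpose a b = transpose c d" using 2 by (simp add: fun_eq_iff inj_eq)
      then show "z = z'" using zz transpose_less_inject[of a b c d] \<open>p = q\<close> by (simp add: W1_def z)
    qed
    show "(\<lambda>(p, a, b). (p, p \<circ> transpose a b)) ` W1 \<subseteq> edge_boundary n A"
    proof clarify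
      fix p a b assume "(p, a, b) \<in> W1"
      then have *: "p \<in> A" "a \<in> {1..n}" "b \<in> {1..n}" "p \<circ> transpose a b \<notin> A" "a < b" by (auto simp: W1_def)
      have p: "p permutes {1..n}" using * A by (auto simp: Sym_def)
      have q: "p \<circ> transpose a b \<in> Sym n" using * A by (intro Sym_transpose) auto
      \<comment> \<open>Conjugation by \<open>p\<close> turns the swap of positions into the swap of
        values that adjacency asks for.\<close>
      have "p \<circ> inv (p \<circ> transpose a b) = transpose (p a) (p b)"
      proof -
        have "inv (p \<circ> transpose a b) = inv p \<circ> transpose (p a) (p b)"
          unfolding permutes_comp_transpose[OF p] using permutes_bij[OF p] by (simp add: o_inv_distrib)
        then show ?thesis
          using permutes_inv_o(1)[OF p] by (simp only: comp_assoc[symmetric] id_comp)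
      qed
      moreover have "p a \<in> {1..n}" "p b \<in> {1..n}" using permutes_in_image[OF p] * by blast+
      moreover have "p a \<noteq> p b" using * permutes_inj[OF p] by (auto simp: inj_eq)
      ultimately show "(p, p \<circ> transpose a b) \<in> edge_boundary n A"
        using * A q unfolding edge_boundary_def trans_adj_def by blast
    qed
  qed (rule finE)
  moreover have "card ?W \<le> card W1 + card (sw ` W1)"
    by (rule order_trans[OF card_mono[OF _ W] card_Un_le]) (use finW1 in simp)
  moreover have "card (sw ` W1) \<le> card W1" by (rule card_image_le[OF finW1])
  ultimately show ?thesis by linarith
qed

text \<open>The factor 4 arises because both endpoints of an edge see the jump and both orders of
  the swapped pair are summed.\<close>

lemma ener_indicator_le:
  assumes A: "A \<subseteq> Sym n"
  shows "ener n {1..n} (\<lambda>p. of_bool (p \<in> A)) \<le> 4 * real (card (edge_boundary n A))"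
proof -
  let ?X = "{1..n}"
  let ?f = "\<lambda>p. of_bool (p \<in> A) :: real"
  have 1: "sq n (dif a b ?f) = 2 * (\<Sum>p\<in>Sym n. of_bool (p \<in> A \<and> p \<circ> transpose a b \<notin> A))"
    if "a \<in> ?X" "b \<in> ?X" for a b
  proof -
    have "sq n (dif a b ?f) = (\<Sum>p\<in>Sym n. of_bool (p \<in> A \<and> p \<circ> transpose a b \<notin> A)) +
       (\<Sum>p\<in>Sym n. of_bool (p \<circ> transpose a b \<in> A \<and> p \<circ> transpose a b \<circ> transpose a b \<notin> A))"
      unfolding sq_def sum.distrib[symmetric] by (intro sum.cong refl) (auto simp: dif_def comp_assoc)
    then show ?thesis
      using sum_Sym_transpose[OF that, of "\<lambda>p. of_bool (p \<in> A \<and> p \<circ> transpose a b \<notin> A) :: real"] by simp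
  qed
  have "ener n ?X ?f = 2 * (\<Sum>a\<in>?X. \<Sum>b\<in>?X. \<Sum>p\<in>Sym n. of_bool (p \<in> A \<and> p \<circ> transpose a b \<notin> A))"
    unfolding ener_def by (simp add: 1 sum_distrib_left del: One_nat_def)
  also have "(\<Sum>a\<in>?X. \<Sum>b\<in>?X. \<Sum>p\<in>Sym n. of_bool (p \<in> A \<and> p \<circ> transpose a b \<notin> A)) =
      (\<Sum>p\<in>Sym n. \<Sum>a\<in>?X. \<Sum>b\<in>?X. of_bool (p \<in> A \<and> p \<circ> transpose a b \<notin> A) :: real)"
    by (simp only: sum.swap[of _ "Sym n"])
  also have "\<dots> = (\<Sum>(p,a,b)\<in>Sym n \<times> ?X \<times> ?X. of_bool (p \<in> A \<and> p \<circ> transpose a b \<notin> A))"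
    by (simp only: sum.cartesian_product)
  also have "\<dots> = real (card (Sym n \<times> ?X \<times> ?X \<inter> {(p, a, b). p \<in> A \<and> p \<circ> transpose a b \<notin> A}))"
    unfolding case_prod_beta by (simp add: case_prod_beta del: One_nat_def)
  also have "Sym n \<times> ?X \<times> ?X \<inter> {(p, a, b). p \<in> A \<and> p \<circ> transpose a b \<notin> A} =
      {(p, a, b). p \<in> A \<and> a \<in> {1..n} \<and> b \<in> {1..n} \<and> p \<circ> transpose a b \<notin> A}"
    using A by auto
  finally show ?thesis using card_inner_boundary_le[OF A] by linarith
qed

subsection \<open>Rectangles\<close>

lemma permutes_extend:
  assumes "finite K" "K \<subseteq> S" "inj_on \<phi> K" "\<phi> ` K \<subseteq> S"
  shows "\<exists>p. p permutes S \<and> (\<forall>i\<in>K. p i = \<phi> i)"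
  using assms
proof (induction K rule: finite_induct)
  case empty
  show ?case using permutes_id[of S] by blast
next
  case (insert k K)
  then obtain p where p: "p permutes S" "\<And>i. i \<in> K \<Longrightarrow> p i = \<phi> i" by auto
  have kS: "k \<in> S" "\<phi> k \<in> S" using insert.prems by auto
  then have pk: "p k \<in> S" using permutes_in_image[OF p(1)] by simp
  have "(transpose (p k) (\<phi> k) \<circ> p) permutes S"
    using p(1) permutes_swap_id[OF pk kS(2)] by (rule permutes_compose)
  moreover have "(transpose (p k) (\<phi> k) \<circ> p) i = \<phi> i" if "i \<in> insert k K" for i
  proof (cases "i = k")
    case True then show ?thesis by simp
  next
    case False
    then have i: "i \<in> K" using that by simp
    have "\<phi> i \<noteq> \<phi> k" using insert.prems(2) i False by (auto simp: inj_on_def)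
    moreover have "p i \<noteq> p k" using permutes_inj[OF p(1)] False by (auto simp: inj_eq)
    ultimately show ?thesis using p(2)[OF i] by simp
  qed
  ultimately show ?case by blast
qed

lemma permutes_agree:
  assumes p: "p permutes S" and q: "q permutes S" and eq: "\<And>i. i \<in> K \<Longrightarrow> q i = p i"
  shows "\<exists>s. s permutes (S - K) \<and> q = p \<circ> s"
proof (intro exI conjI)
  have "(inv p \<circ> q) permutes S" using p q by (intro permutes_compose permutes_inv)
  then show "(inv p \<circ> q) permutes (S - K)"
    by (rule permutes_superset) (auto simp: eq permutes_inverses[OF p])
  show "q = p \<circ> (inv p \<circ> q)" by (simp add: fun_eq_iff permutes_inverses[OF p])
qed

lemma card_permutes_extending:
  assumes S: "finite S" and K: "K \<subseteq> S" "inj_on \<phi> K" "\<phi> ` K \<subseteq> S"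
  shows "card {p. p permutes S \<and> (\<forall>i\<in>K. p i = \<phi> i)} = fact (card S - card K)"
proof -
  have finK: "finite K" using S K finite_subset by blast
  obtain p where p: "p permutes S" "\<And>i. i \<in> K \<Longrightarrow> p i = \<phi> i"
    using permutes_extend[OF finK K] by blast
  have img: "{q. q permutes S \<and> (\<forall>i\<in>K. q i = \<phi> i)} = (\<lambda>s. p \<circ> s) ` {s. s permutes (S - K)}"
  proof (intro equalityI subsetI)
    fix q assume "q \<in> {q. q permutes S \<and> (\<forall>i\<in>K. q i = \<phi> i)}"
    then have "\<exists>s. s permutes (S - K) \<and> q = p \<circ> s"
      using p(2) by (intro permutes_agree[OF p(1)]) auto
    then show "q \<in> (\<lambda>s. p \<circ> s) ` {s. s permutes (S - K)}" by blast
  next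
    fix q assume "q \<in> (\<lambda>s. p \<circ> s) ` {s. s permutes (S - K)}"
    then obtain s where s: "q = p \<circ> s" "s permutes (S - K)" by auto
    have "s permutes S" using s(2) by (rule permutes_subset) auto
    moreover have "s i = i" if "i \<in> K" for i using permutes_not_in[OF s(2)] that by simp
    ultimately show "q \<in> {q. q permutes S \<and> (\<forall>i\<in>K. q i = \<phi> i)}"
      using p by (auto simp: s(1) intro: permutes_compose)
  qed
  have "inj_on (\<lambda>s. p \<circ> s) {s. s permutes (S - K)}"
    by (intro inj_onI) (simp add: fun_eq_iff inj_eq[OF permutes_inj[OF p(1)]])
  then have "card {q. q permutes S \<and> (\<forall>i\<in>K. q i = \<phi> i)} = card {s. s permutes (S - K)}"
    unfolding img by (rule card_image)
  also have "\<dots> = fact (card (S - K))" using S by (intro card_permutations[OF refl]) auto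
  finally show ?thesis using card_Diff_subset[OF finK K(1)] by simp
qed

lemma sum_permutes_two_points:
  fixes h :: "'a \<Rightarrow> 'a \<Rightarrow> real"
  assumes S: "finite S" and st: "s \<in> S" "t \<in> S" "s \<noteq> t"
  shows "(\<Sum>p | p permutes S. h (p s) (p t)) = fact (card S - 2) * (\<Sum>x\<in>S. \<Sum>y\<in>S - {x}. h x y)"
proof -
  let ?P = "{p. p permutes S}"
  have finP: "finite ?P" using S by (rule finite_permutations)
  define D where "D = (SIGMA x:S. S - {x})"
  have finD: "finite D" using S by (simp add: D_def)
  have "(\<Sum>p\<in>?P. h (p s) (p t)) = (\<Sum>z\<in>D. \<Sum>p | p \<in> ?P \<and> (p s, p t) = z. h (p s) (p t))"
  proof (rule sum.group[OF finP finD, symmetric], rule image_subsetI)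
    fix p assume "p \<in> ?P"
    then have p: "p permutes S" by simp
    show "(p s, p t) \<in> D"
      using st permutes_in_image[OF p] permutes_inj[OF p] by (simp add: D_def inj_eq)
  qed
  also have "\<dots> = (\<Sum>z\<in>D. fact (card S - 2) * h (fst z) (snd z))"
  proof (rule sum.cong[OF refl])
    fix z assume "z \<in> D"
    then obtain x y where z: "z = (x, y)" "x \<in> S" "y \<in> S" "x \<noteq> y" by (auto simp: D_def)
    have "{p \<in> ?P. (p s, p t) = z} = {p. p permutes S \<and> (\<forall>i\<in>{s,t}. p i = (if i = s then x else y))}"
      using st by (auto simp: z(1))
    also have "card \<dots> = fact (card S - card {s,t})"
      by (rule card_permutes_extending[OF S]) (use st z in \<open>auto simp: inj_on_def\<close>)
    finally have "card {p \<in> ?P. (p s, p t) = z} = fact (card S - 2)" using st by (simp add: numeral_2_eq_2)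
    moreover have "(\<Sum>p | p \<in> ?P \<and> (p s, p t) = z. h (p s) (p t)) = (\<Sum>p\<in>{p \<in> ?P. (p s, p t) = z}. h x y)"
      by (rule sum.cong) (auto simp: z)
    ultimately show "(\<Sum>p | p \<in> ?P \<and> (p s, p t) = z. h (p s) (p t)) = fact (card S - 2) * h (fst z) (snd z)"
      by (simp add: z)
  qed
  also have "\<dots> = fact (card S - 2) * (\<Sum>x\<in>S. \<Sum>y\<in>S - {x}. h x y)"
    unfolding D_def using S by (simp add: sum.Sigma sum_distrib_left case_prod_beta)
  finally show ?thesis .
qed

text \<open>Permutations that agree at \<open>a\<close> and \<open>b\<close> differ by a permutation
  of the other positions, over which \<open>psi\<close> is averaged. Hence one permutation through a
  rectangle speaks for all of them, as \<open>rects_iff\<close> records.\<close>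

lemma psi_cong:
  assumes "p \<in> Sym n" "q \<in> Sym n" "q a = p a" "q b = p b"
  shows "psi n g a b q = psi n g a b p"
proof -
  obtain s where "s permutes ({1..n} - {a,b})" "q = p \<circ> s"
    using permutes_agree[of p "{1..n}" q "{a,b}"] assms by (auto simp: Sym_def)
  then show ?thesis by (simp add: psi_def av_permute)
qed

lemma psi_transpose: "psi n g a b (p \<circ> transpose a b) = - psi n g a b p"
proof -
  have "dif a b g (p \<circ> transpose a b \<circ> s) = - dif a b g (p \<circ> s)" if "s permutes ({1..n} - {a,b})" for s
  proof -
    have "s a = a" "s b = b" using permutes_not_in[OF that] by auto
    then have "transpose a b \<circ> s = s \<circ> transpose a b" using permutes_comp_transpose[OF that, of a b] by simp
    then show ?thesis by (simp add: dif_def comp_assoc)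
  qed
  then show ?thesis by (simp add: psi_def av_def sum_negf)
qed

text \<open>A tuple \<open>(a, b, x, y)\<close> stands for the positions \<open>a, b\<close> and the values \<open>x, y\<close> taken there; viewing a
  permutation as a permutation matrix, these are two rows and two columns.\<close>

definition pos_rects :: "nat \<Rightarrow> ((nat \<Rightarrow> nat) \<Rightarrow> real) \<Rightarrow> (nat \<times> nat \<times> nat \<times> nat) set" where
  "pos_rects n g = {(a, b, x, y). a \<in> {1..n} \<and> b \<in> {1..n} \<and>
     (\<exists>p\<in>Sym n. p a = x \<and> p b = y \<and> 1/2 < psi n g a b p)}"

definition neg_rects :: "nat \<Rightarrow> ((nat \<Rightarrow> nat) \<Rightarrow> real) \<Rightarrow> (nat \<times> nat \<times> nat \<times> nat) set" where
  "neg_rects n g = {(a, b, x, y). a \<in> {1..n} \<and> b \<in> {1..n} \<and>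
     (\<exists>p\<in>Sym n. p a = x \<and> p b = y \<and> psi n g a b p < -1/2)}"

definition rects :: "nat \<Rightarrow> ((nat \<Rightarrow> nat) \<Rightarrow> real) \<Rightarrow> (nat \<times> nat \<times> nat \<times> nat) set" where
  "rects n g = pos_rects n g \<union> neg_rects n g"

lemma rects_iff:
  assumes "p \<in> Sym n" "a \<in> {1..n}" "b \<in> {1..n}"
  shows "(a, b, p a, p b) \<in> pos_rects n g \<longleftrightarrow> 1/2 < psi n g a b p"
    and "(a, b, p a, p b) \<in> neg_rects n g \<longleftrightarrow> psi n g a b p < -1/2"
    and "(a, b, p a, p b) \<in> rects n g \<longleftrightarrow> 1/2 < \<bar>psi n g a b p\<bar>"
proof -
  have ex: "(\<exists>q\<in>Sym n. q a = p a \<and> q b = p b \<and> P (psi n g a b q)) \<longleftrightarrow> P (psi n g a b p)" for P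
  proof
    assume "\<exists>q\<in>Sym n. q a = p a \<and> q b = p b \<and> P (psi n g a b q)"
    then obtain q where q: "q \<in> Sym n" "q a = p a" "q b = p b" "P (psi n g a b q)" by blast
    show "P (psi n g a b p)" using q(4) unfolding psi_cong[OF assms(1) q(1-3)] .
  qed (use assms(1) in blast)
  show 1: "(a, b, p a, p b) \<in> pos_rects n g \<longleftrightarrow> 1/2 < psi n g a b p"
    using assms(2,3) ex[of "\<lambda>t. 1/2 < t"] by (simp add: pos_rects_def)
  show 2: "(a, b, p a, p b) \<in> neg_rects n g \<longleftrightarrow> psi n g a b p < -1/2"
    using assms(2,3) ex[of "\<lambda>t. t < -1/2"] by (simp add: neg_rects_def)
  show "(a, b, p a, p b) \<in> rects n g \<longleftrightarrow> 1/2 < \<bar>psi n g a b p\<bar>"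
    unfolding rects_def Un_iff 1 2 by linarith
qed

text \<open>By \<open>psi_transpose\<close>, exchanging the two values reverses the sign; so each
  rectangle has a partner of the other sign on the same four lines.\<close>

lemma rects_flip: "(a, b, y, x) \<in> neg_rects n g \<longleftrightarrow> (a, b, x, y) \<in> pos_rects n g"
proof
  assume "(a, b, y, x) \<in> neg_rects n g"
  then obtain p where p: "a \<in> {1..n}" "b \<in> {1..n}" "p \<in> Sym n" "p a = y" "p b = x" "psi n g a b p < -1/2"
    by (auto simp: neg_rects_def)
  then show "(a, b, x, y) \<in> pos_rects n g"
    using Sym_transpose[OF p(3,1,2)] psi_transpose[of n g a b p]
    unfolding pos_rects_def by (auto intro!: bexI[of _ "p \<circ> transpose a b"])
next
  assume "(a, b, x, y) \<in> pos_rects n g"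
  then obtain p where p: "a \<in> {1..n}" "b \<in> {1..n}" "p \<in> Sym n" "p a = x" "p b = y" "1/2 < psi n g a b p"
    by (auto simp: pos_rects_def)
  then show "(a, b, y, x) \<in> neg_rects n g"
    using Sym_transpose[OF p(3,1,2)] psi_transpose[of n g a b p]
    unfolding neg_rects_def by (auto intro!: bexI[of _ "p \<circ> transpose a b"])
qed

lemma rects_subset: "rects n g \<subseteq> {(a, b, x, y). a \<in> {1..n} \<and> b \<in> {1..n} \<and> x \<in> {1..n} \<and> y \<in> {1..n} \<and> a \<noteq> b \<and> x \<noteq> y}"
proof (rule subsetI)
  fix R assume "R \<in> rects n g"
  then obtain a b p where R: "R = (a, b, p a, p b)" "a \<in> {1..n}" "b \<in> {1..n}" "p \<in> Sym n" "psi n g a b p \<noteq> 0"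
    by (fastforce simp: rects_def pos_rects_def neg_rects_def)
  then have p: "p permutes {1..n}" by (simp add: Sym_def)
  have "a \<noteq> b" using R(5) by auto
  moreover from this have "p a \<noteq> p b" using permutes_inj[OF p] by (auto simp: inj_eq)
  ultimately show "R \<in> {(a, b, x, y). a \<in> {1..n} \<and> b \<in> {1..n} \<and> x \<in> {1..n} \<and> y \<in> {1..n} \<and> a \<noteq> b \<and> x \<noteq> y}"
    using R permutes_in_image[OF p] by simp
qed

lemma rectsD:
  assumes "(a, b, x, y) \<in> rects n g"
  shows "a \<in> {1..n}" "b \<in> {1..n}" "x \<in> {1..n}" "y \<in> {1..n}" "a \<noteq> b" "x \<noteq> y"
  using subsetD[OF rects_subset assms] by auto

lemma rects_diag [simp]: "(a, a, x, y) \<notin> rects n g" "(a, b, x, x) \<notin> rects n g"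
  using rectsD(5)[of a a x y n g] rectsD(6)[of a b x x n g] by blast+

lemma finite_rects [simp]: "finite (rects n g)"
  by (rule finite_subset[of _ "{1..n} \<times> {1..n} \<times> {1..n} \<times> {1..n}"]) (auto dest: rectsD(1-4) simp del: atLeastAtMost_iff)

text \<open>Double counting: a rectangle prescribes two values and so fits
  \<open>fact (n - 2)\<close> permutations. Degenerate tuples with \<open>a = b\<close> or
  \<open>x = y\<close> are never rectangles and contribute nothing.\<close>

lemma sum_rects:
  "(\<Sum>a\<in>{1..n}. \<Sum>b\<in>{1..n}. \<Sum>p\<in>Sym n. of_bool ((a, b, p a, p b) \<in> rects n g \<and> Q (a, b, p a, p b)))
    = fact (n - 2) * real (card {R \<in> rects n g. Q R})"
proof -
  let ?X = "{1..n}"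
  let ?H = "\<lambda>a b x y. of_bool ((a, b, x, y) \<in> rects n g \<and> Q (a, b, x, y)) :: real"
  have inner: "(\<Sum>p\<in>Sym n. ?H a b (p a) (p b)) = fact (n - 2) * (\<Sum>x\<in>?X. \<Sum>y\<in>?X. ?H a b x y)"
    if ab: "a \<in> ?X" "b \<in> ?X" for a b
  proof (cases "a = b")
    case True
    then show ?thesis by simp
  next
    case False
    have "(\<Sum>p\<in>Sym n. ?H a b (p a) (p b)) = fact (n - 2) * (\<Sum>x\<in>?X. \<Sum>y\<in>?X - {x}. ?H a b x y)"
      using sum_permutes_two_points[of ?X a b "?H a b"] ab False by (simp add: Sym_def)
    also have "(\<Sum>x\<in>?X. \<Sum>y\<in>?X - {x}. ?H a b x y) = (\<Sum>x\<in>?X. \<Sum>y\<in>?X. ?H a b x y)"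
      by (rule sum.cong[OF refl], rule sum.mono_neutral_left) auto
    finally show ?thesis .
  qed
  have "(\<Sum>a\<in>?X. \<Sum>b\<in>?X. \<Sum>p\<in>Sym n. ?H a b (p a) (p b)) =
      (\<Sum>a\<in>?X. \<Sum>b\<in>?X. fact (n - 2) * (\<Sum>x\<in>?X. \<Sum>y\<in>?X. ?H a b x y))"
    by (rule sum.cong[OF refl], rule sum.cong[OF refl], rule inner)
  also have "\<dots> = fact (n - 2) * (\<Sum>a\<in>?X. \<Sum>b\<in>?X. \<Sum>x\<in>?X. \<Sum>y\<in>?X. ?H a b x y)"
    by (simp only: sum_distrib_left)
  also have "(\<Sum>a\<in>?X. \<Sum>b\<in>?X. \<Sum>x\<in>?X. \<Sum>y\<in>?X. ?H a b x y) =
      (\<Sum>R\<in>?X \<times> ?X \<times> ?X \<times> ?X. of_bool (R \<in> rects n g \<and> Q R))"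
    unfolding sum.cartesian_product by (rule sum.cong[OF refl]) auto
  also have "\<dots> = real (card ((?X \<times> ?X \<times> ?X \<times> ?X) \<inter> {R. R \<in> rects n g \<and> Q R}))" by simp
  also have "(?X \<times> ?X \<times> ?X \<times> ?X) \<inter> {R. R \<in> rects n g \<and> Q R} = {R \<in> rects n g. Q R}"
    by (auto dest: rectsD(1-4) simp del: atLeastAtMost_iff)
  finally show ?thesis .
qed

lemma sum4_rects:
  "(\<Sum>a\<in>{1..n}. \<Sum>b\<in>{1..n}. \<Sum>x\<in>{1..n}. \<Sum>y\<in>{1..n}. of_bool ((a, b, x, y) \<in> rects n g)) = real (card (rects n g))"
proof -
  let ?X = "{1..n}"
  have "(\<Sum>a\<in>?X. \<Sum>b\<in>?X. \<Sum>x\<in>?X. \<Sum>y\<in>?X. of_bool ((a, b, x, y) \<in> rects n g)) =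
      (\<Sum>R\<in>?X \<times> ?X \<times> ?X \<times> ?X. of_bool (R \<in> rects n g) :: real)"
    unfolding sum.cartesian_product by (rule sum.cong[OF refl]) auto
  also have "\<dots> = real (card ((?X \<times> ?X \<times> ?X \<times> ?X) \<inter> {R. R \<in> rects n g}))" by simp
  also have "(?X \<times> ?X \<times> ?X \<times> ?X) \<inter> {R. R \<in> rects n g} = rects n g"
    by (auto dest: rectsD(1-4) simp del: atLeastAtMost_iff)
  finally show ?thesis .
qed

lemma fact_split2: "n \<ge> 2 \<Longrightarrow> fact n = real n * (real n - 1) * fact (n - 2)"
  by (cases n; cases "n - 1") (auto simp: algebra_simps)

text \<open>Markov's inequality at the threshold 1/2; it replaces the trivial order
  \<open>n ^ 4\<close> by \<open>n ^ 3\<close>.\<close>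

lemma card_rects_le:
  assumes n: "n \<ge> 2" and small: "(\<Sum>a\<in>{1..n}. \<Sum>b\<in>{1..n}. sq n (psi n g a b)) \<le> 2 * real n * fact n"
  shows "real (card (rects n g)) \<le> 8 * real n ^ 3"
proof -
  have "fact (n - 2) * real (card (rects n g)) =
      (\<Sum>a\<in>{1..n}. \<Sum>b\<in>{1..n}. \<Sum>p\<in>Sym n. of_bool ((a, b, p a, p b) \<in> rects n g))"
    using sum_rects[of n g "\<lambda>_. True"] by simp
  also have "\<dots> \<le> (\<Sum>a\<in>{1..n}. \<Sum>b\<in>{1..n}. 4 * sq n (psi n g a b))"
  proof (intro sum_mono)
    fix a b assume ab: "a \<in> {1..n}" "b \<in> {1..n}"
    have "of_bool ((a, b, p a, p b) \<in> rects n g) \<le> 4 * (psi n g a b p)\<^sup>2" if "p \<in> Sym n" for p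
    proof (cases "1/2 < \<bar>psi n g a b p\<bar>")
      case True
      then have "(1/2)\<^sup>2 \<le> \<bar>psi n g a b p\<bar>\<^sup>2" by (intro power_mono) auto
      then show ?thesis by (simp add: power2_eq_square)
    qed (simp add: rects_iff[OF that ab])
    then show "(\<Sum>p\<in>Sym n. of_bool ((a, b, p a, p b) \<in> rects n g)) \<le> 4 * sq n (psi n g a b)"
      unfolding sq_def sum_distrib_left by (rule sum_mono)
  qed
  also have "\<dots> = 4 * (\<Sum>a\<in>{1..n}. \<Sum>b\<in>{1..n}. sq n (psi n g a b))"
    by (simp only: sum_distrib_left)
  also have "\<dots> \<le> 8 * real n * fact n" using small by linarith
  also have "\<dots> = fact (n - 2) * (8 * real n * (real n * (real n - 1)))"
    unfolding fact_split2[OF n] by simp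
  finally have "real (card (rects n g)) \<le> 8 * real n * (real n * (real n - 1))"
    by (rule mult_left_le_imp_le) simp
  also have "\<dots> \<le> 8 * real n * (real n * real n)" by (intro mult_left_mono) auto
  finally show ?thesis by (simp add: power3_eq_cube)
qed

text \<open>The number of rectangles through \<open>p\<close>. If there are \<open>O(n^3)\<close>
  rectangles its mean is \<open>O(n)\<close>, though a single value can be of order
  \<open>n^2\<close>.\<close>

definition heavy_count :: "nat \<Rightarrow> ((nat \<Rightarrow> nat) \<Rightarrow> real) \<Rightarrow> (nat \<Rightarrow> nat) \<Rightarrow> real" where
  "heavy_count n g p = (\<Sum>s\<in>{1..n}. \<Sum>t\<in>{1..n}. of_bool ((s, t, p s, p t) \<in> rects n g))"

lemma av_rects_le:
  assumes n: "n \<ge> 20" and Y: "Y \<subseteq> {1..n}" "n \<le> card Y + 4" and p: "p \<in> Sym n"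
  shows "av Y (\<lambda>p. \<Sum>s\<in>Y. \<Sum>t\<in>Y. of_bool ((s, t, p s, p t) \<in> rects n g)) p
     \<le> real (card (rects n g)) / ((real n - 4) * (real n - 5))"
proof -
  let ?X = "{1..n}"
  let ?w = "\<lambda>s t x y. of_bool ((s, t, x, y) \<in> rects n g) :: real"
  define m where "m = card Y"
  have finY: "finite Y" using Y finite_subset by blast
  have bij: "bij_betw p ?X ?X" using p by (simp add: Sym_def permutes_imp_bij)
  have m: "real m \<ge> real n - 4" "m \<ge> 2" using Y n by (auto simp: m_def)
  have pos: "(real n - 4) * (real n - 5) > 0" using n by simp
  have one: "av Y (\<lambda>p. ?w s t (p s) (p t)) p \<le> (\<Sum>x\<in>?X. \<Sum>y\<in>?X. ?w s t x y) / ((real n - 4) * (real n - 5))"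
    if st: "s \<in> Y" "t \<in> Y" for s t
  proof (cases "s = t")
    case True
    then show ?thesis by (simp add: av_def)
  next
    case False
    have "av Y (\<lambda>p. ?w s t (p s) (p t)) p = fact (m - 2) * (\<Sum>x\<in>Y. \<Sum>y\<in>Y - {x}. ?w s t (p x) (p y)) / fact m"
      unfolding av_def m_def comp_apply
      using sum_permutes_two_points[OF finY st False, of "\<lambda>x y. ?w s t (p x) (p y)"] by simp
    also have "\<dots> = (\<Sum>x\<in>Y. \<Sum>y\<in>Y - {x}. ?w s t (p x) (p y)) / (real m * (real m - 1))"
      unfolding fact_split2[OF m(2)] by simp
    also have "\<dots> \<le> (\<Sum>x\<in>?X. \<Sum>y\<in>?X. ?w s t (p x) (p y)) / (real m * (real m - 1))"
    proof (rule divide_right_mono)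
      have "(\<Sum>x\<in>Y. \<Sum>y\<in>Y - {x}. ?w s t (p x) (p y)) \<le> (\<Sum>x\<in>Y. \<Sum>y\<in>?X. ?w s t (p x) (p y))"
        using Y by (intro sum_mono sum_mono2) auto
      also have "\<dots> \<le> (\<Sum>x\<in>?X. \<Sum>y\<in>?X. ?w s t (p x) (p y))"
        using Y by (intro sum_mono2 sum_nonneg) auto
      finally show "(\<Sum>x\<in>Y. \<Sum>y\<in>Y - {x}. ?w s t (p x) (p y)) \<le> (\<Sum>x\<in>?X. \<Sum>y\<in>?X. ?w s t (p x) (p y))" .
    qed (use m in simp)
    also have "\<dots> \<le> (\<Sum>x\<in>?X. \<Sum>y\<in>?X. ?w s t (p x) (p y)) / ((real n - 4) * (real n - 5))"
      using m n pos by (intro divide_left_mono mult_mono sum_nonneg mult_pos_pos) auto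
    also have "(\<Sum>x\<in>?X. \<Sum>y\<in>?X. ?w s t (p x) (p y)) = (\<Sum>x\<in>?X. \<Sum>y\<in>?X. ?w s t (p x) y)"
      by (rule sum.cong[OF refl], rule sum.reindex_bij_betw[OF bij])
    also have "\<dots> = (\<Sum>x\<in>?X. \<Sum>y\<in>?X. ?w s t x y)"
      by (rule sum.reindex_bij_betw[OF bij])
    finally show ?thesis .
  qed
  have "av Y (\<lambda>p. \<Sum>s\<in>Y. \<Sum>t\<in>Y. ?w s t (p s) (p t)) p = (\<Sum>s\<in>Y. \<Sum>t\<in>Y. av Y (\<lambda>p. ?w s t (p s) (p t)) p)"
    by (simp only: av_sum)
  also have "\<dots> \<le> (\<Sum>s\<in>Y. \<Sum>t\<in>Y. (\<Sum>x\<in>?X. \<Sum>y\<in>?X. ?w s t x y) / ((real n - 4) * (real n - 5)))"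
    by (intro sum_mono one)
  also have "\<dots> = (\<Sum>s\<in>Y. \<Sum>t\<in>Y. (\<Sum>x\<in>?X. \<Sum>y\<in>?X. ?w s t x y)) / ((real n - 4) * (real n - 5))"
    by (simp only: sum_divide_distrib)
  also have "\<dots> \<le> (\<Sum>s\<in>?X. \<Sum>t\<in>?X. (\<Sum>x\<in>?X. \<Sum>y\<in>?X. ?w s t x y)) / ((real n - 4) * (real n - 5))"
  proof (rule divide_right_mono)
    have "(\<Sum>s\<in>Y. \<Sum>t\<in>Y. (\<Sum>x\<in>?X. \<Sum>y\<in>?X. ?w s t x y)) \<le> (\<Sum>s\<in>Y. \<Sum>t\<in>?X. (\<Sum>x\<in>?X. \<Sum>y\<in>?X. ?w s t x y))"
      by (rule sum_mono, rule sum_mono2) (use Y in \<open>auto intro!: sum_nonneg simp del: sum_of_bool_eq\<close>)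
    also have "\<dots> \<le> (\<Sum>s\<in>?X. \<Sum>t\<in>?X. (\<Sum>x\<in>?X. \<Sum>y\<in>?X. ?w s t x y))"
      by (rule sum_mono2) (use Y in \<open>auto intro!: sum_nonneg simp del: sum_of_bool_eq\<close>)
    finally show "(\<Sum>s\<in>Y. \<Sum>t\<in>Y. (\<Sum>x\<in>?X. \<Sum>y\<in>?X. ?w s t x y)) \<le> (\<Sum>s\<in>?X. \<Sum>t\<in>?X. (\<Sum>x\<in>?X. \<Sum>y\<in>?X. ?w s t x y))" .
  qed (use pos in simp)
  finally show ?thesis unfolding sum4_rects .
qed

text \<open>At most \<open>2 * 4 * n\<close> ordered pairs of positions touch
  \<open>K\<close>.\<close>

lemma heavy_count_le:
  assumes K: "finite K" "card K \<le> 4"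
  shows "heavy_count n g p \<le> (\<Sum>s\<in>{1..n} - K. \<Sum>t\<in>{1..n} - K. of_bool ((s, t, p s, p t) \<in> rects n g)) + 8 * real n"
proof -
  let ?X = "{1..n}"
  let ?w = "\<lambda>s t. of_bool ((s, t, p s, p t) \<in> rects n g) :: real"
  have c: "real (card (?X \<inter> K)) \<le> 4" using K card_mono[OF K(1), of "?X \<inter> K"] by simp
  have "heavy_count n g p \<le> (\<Sum>s\<in>?X. \<Sum>t\<in>?X. (if s \<in> ?X - K then if t \<in> ?X - K then ?w s t else 0 else 0) + (of_bool (s \<in> K) + of_bool (t \<in> K)))"
    unfolding heavy_count_def by (intro sum_mono) auto
  also have "\<dots> = (\<Sum>s\<in>?X. \<Sum>t\<in>?X. (if s \<in> ?X - K then if t \<in> ?X - K then ?w s t else 0 else 0)) + 2 * real n * real (card (?X \<inter> K))"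
    by (simp add: sum.distrib sum_distrib_left)
  also have "(\<Sum>s\<in>?X. \<Sum>t\<in>?X. (if s \<in> ?X - K then if t \<in> ?X - K then ?w s t else 0 else 0)) = (\<Sum>s\<in>?X - K. \<Sum>t\<in>?X - K. ?w s t)"
  proof -
    have "(\<Sum>s\<in>?X. \<Sum>t\<in>?X. (if s \<in> ?X - K then if t \<in> ?X - K then ?w s t else 0 else 0)) =
        (\<Sum>s\<in>?X - K. \<Sum>t\<in>?X. (if s \<in> ?X - K then if t \<in> ?X - K then ?w s t else 0 else 0))"
      by (rule sum.mono_neutral_right) auto
    also have "\<dots> = (\<Sum>s\<in>?X - K. \<Sum>t\<in>?X - K. ?w s t)"
      by (rule sum.cong[OF refl], rule sum.mono_neutral_cong_right) auto
    finally show ?thesis .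
  qed
  also have "2 * real n * real (card (?X \<inter> K)) \<le> 2 * real n * 4" using c by (intro mult_left_mono) auto
  finally show ?thesis by simp
qed

text \<open>The weight \<open>u\<close> depends only on the values on \<open>K\<close>, so the count
  of rectangles off \<open>K\<close> may be replaced by its conditional mean, at most
  \<open>16 * n\<close>; pairs touching \<open>K\<close> add \<open>8 * n\<close>.\<close>

lemma sum_mult_heavy_count_le:
  assumes n: "n \<ge> 20" and small: "real (card (rects n g)) \<le> 8 * real n ^ 3"
    and K: "K \<subseteq> {1..n}" "card K \<le> 4"
    and u: "\<And>p. u p \<ge> 0" "\<And>p s. p \<in> Sym n \<Longrightarrow> s permutes ({1..n} - K) \<Longrightarrow> u (p \<circ> s) = u p"
  shows "(\<Sum>p\<in>Sym n. u p * heavy_count n g p) \<le> 24 * real n * (\<Sum>p\<in>Sym n. u p)"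
proof -
  let ?Y = "{1..n} - K"
  let ?W = "\<lambda>p. \<Sum>s\<in>?Y. \<Sum>t\<in>?Y. of_bool ((s, t, p s, p t) \<in> rects n g) :: real"
  have finK: "finite K" using K finite_subset by blast
  have cY: "n \<le> card ?Y + 4" using card_Diff_subset[OF finK K(1)] K(2) by simp
  have avW: "av ?Y ?W p \<le> 16 * real n" if "p \<in> Sym n" for p
  proof -
    have "av ?Y ?W p \<le> real (card (rects n g)) / ((real n - 4) * (real n - 5))"
      by (rule av_rects_le[OF n _ cY that]) auto
    also have "\<dots> \<le> 8 * real n ^ 3 / ((real n - 4) * (real n - 5))"
      using n small by (intro divide_right_mono) auto
    also have "\<dots> \<le> 16 * real n"
    proof -
      \<comment> \<open>Equivalent to \<open>n^2 \<le> 2 * (n - 4) * (n - 5)\<close>.\<close>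
      have "0 \<le> (real n - 18) * real n + 40" using n by (intro add_nonneg_nonneg mult_nonneg_nonneg) auto
      then have "0 \<le> real n * ((real n - 18) * real n + 40)" by simp
      then have "8 * real n ^ 3 \<le> 16 * real n * ((real n - 4) * (real n - 5))"
        by (simp add: power3_eq_cube algebra_simps)
      moreover have "(real n - 4) * (real n - 5) > 0" using n by simp
      ultimately show ?thesis by (simp only: pos_divide_le_eq)
    qed
    finally show ?thesis .
  qed
  have "(\<Sum>p\<in>Sym n. u p * heavy_count n g p) \<le> (\<Sum>p\<in>Sym n. u p * ?W p + 8 * real n * u p)"
  proof (rule sum_mono)
    fix p
    have "u p * heavy_count n g p \<le> u p * (?W p + 8 * real n)"
      by (intro mult_left_mono heavy_count_le finK K u)
    then show "u p * heavy_count n g p \<le> u p * ?W p + 8 * real n * u p"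
      by (simp only: distrib_left mult.commute)
  qed
  also have "\<dots> = ip n u ?W + 8 * real n * (\<Sum>p\<in>Sym n. u p)"
    by (simp only: sum.distrib ip_def sum_distrib_left)
  also have "ip n u ?W = ip n u (av ?Y ?W)"
    by (rule ip_av[symmetric]) (use u in auto)
  also have "\<dots> \<le> (\<Sum>p\<in>Sym n. u p * (16 * real n))"
    unfolding ip_def by (intro sum_mono mult_left_mono avW u)
  also have "\<dots> = 16 * real n * (\<Sum>p\<in>Sym n. u p)"
    by (simp only: sum_distrib_right[symmetric] mult.commute)
  finally show ?thesis by simp
qed

text \<open>Only positions are kept: a permutation \<open>p\<close> supplies the values, and
  disjoint rows then force disjoint columns.\<close>

definition bad_quad :: "nat \<Rightarrow> ((nat \<Rightarrow> nat) \<Rightarrow> real) \<Rightarrow> (nat \<Rightarrow> nat) \<Rightarrow> nat \<times> nat \<times> nat \<times> nat \<Rightarrow> bool" where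
  "bad_quad n g p = (\<lambda>(a, b, c, d). {a,b} \<inter> {c,d} = {} \<and> 1/2 < psi n g a b p \<and> psi n g c d p < -1/2)"

definition quads :: "nat \<Rightarrow> (nat \<times> nat \<times> nat \<times> nat) set" where
  "quads n = {1..n} \<times> {1..n} \<times> {1..n} \<times> {1..n}"

lemma finite_quads [simp]: "finite (quads n)"
  by (simp add: quads_def)

definition bad_count :: "nat \<Rightarrow> ((nat \<Rightarrow> nat) \<Rightarrow> real) \<Rightarrow> (nat \<Rightarrow> nat) \<Rightarrow> real" where
  "bad_count n g p = (\<Sum>z\<in>quads n. of_bool (bad_quad n g p z))"

text \<open>Whether a quadruple is bad depends on the values at its four positions alone, so
  conditioning on it keeps the mean number of rectangles below \<open>24 * n\<close>.\<close>

lemma sum_bad_count_mult_le: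
  assumes n: "n \<ge> 20" and small: "real (card (rects n g)) \<le> 8 * real n ^ 3"
  shows "(\<Sum>p\<in>Sym n. bad_count n g p * heavy_count n g p) \<le> 24 * real n * (\<Sum>p\<in>Sym n. bad_count n g p)"
proof -
  have "(\<Sum>p\<in>Sym n. bad_count n g p * heavy_count n g p) =
      (\<Sum>z\<in>quads n. \<Sum>p\<in>Sym n. of_bool (bad_quad n g p z) * heavy_count n g p)"
    unfolding bad_count_def sum_distrib_right by (rule sum.swap)
  also have "\<dots> \<le> (\<Sum>z\<in>quads n. 24 * real n * (\<Sum>p\<in>Sym n. of_bool (bad_quad n g p z)))"
  proof (rule sum_mono)
    fix z assume "z \<in> quads n"
    then obtain a b c d where z: "z = (a, b, c, d)" "{a, b, c, d} \<subseteq> {1..n}" unfolding quads_def by blast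
    show "(\<Sum>p\<in>Sym n. of_bool (bad_quad n g p z) * heavy_count n g p) \<le> 24 * real n * (\<Sum>p\<in>Sym n. of_bool (bad_quad n g p z))"
    proof (rule sum_mult_heavy_count_le[OF n small z(2)])
      show "card {a, b, c, d} \<le> 4" by (simp add: card_insert_if)
      fix p s assume p: "p \<in> Sym n" and s: "s permutes ({1..n} - {a, b, c, d})"
      have q: "p \<circ> s \<in> Sym n" by (rule Sym_comp_permutes[OF p _ s]) auto
      have "s a = a" "s b = b" "s c = c" "s d = d" using permutes_not_in[OF s] by auto
      then have "psi n g a b (p \<circ> s) = psi n g a b p" "psi n g c d (p \<circ> s) = psi n g c d p"
        by (auto intro!: psi_cong[OF p q])
      then show "of_bool (bad_quad n g (p \<circ> s) z) = (of_bool (bad_quad n g p z) :: real)"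
        by (simp add: bad_quad_def z)
    qed simp
  qed
  also have "\<dots> = 24 * real n * (\<Sum>p\<in>Sym n. bad_count n g p)"
    unfolding bad_count_def sum_distrib_left by (rule sum.swap)
  finally show ?thesis .
qed

text \<open>A Boolean function takes one value at \<open>p\<close>, so all its differences at \<open>p\<close> have the same sign;
  a rectangle of the other sign must contribute to the error.\<close>

lemma bad_count_mult_le:
  assumes n: "n > 0" and p: "p \<in> Sym n" and f01: "\<And>p. p \<in> Sym n \<Longrightarrow> f p = 0 \<or> f p = (1::real)"
  shows "bad_count n f p * (1 - heavy_count n f p / (48 * real n))
    \<le> 192 * real n * (\<Sum>a\<in>{1..n}. \<Sum>b\<in>{1..n}. (dif a b f p - psi n f a b p)\<^sup>2)"
proof -
  let ?X = "{1..n}"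
  define E where "E = (\<Sum>a\<in>?X. \<Sum>b\<in>?X. (dif a b f p - psi n f a b p)\<^sup>2)"
  define P where "P = (\<Sum>a\<in>?X. \<Sum>b\<in>?X. of_bool (1/2 < psi n f a b p) :: real)"
  define R where "R = (\<Sum>a\<in>?X. \<Sum>b\<in>?X. of_bool (psi n f a b p < -1/2) :: real)"
  define M where "M = heavy_count n f p"
  define D where "D = bad_count n f p"
  have M: "M = (\<Sum>a\<in>?X. \<Sum>b\<in>?X. of_bool (1/2 < \<bar>psi n f a b p\<bar>))"
    unfolding M_def heavy_count_def by (intro sum.cong refl) (simp add: rects_iff[OF p])
  have PM: "P \<le> M" "R \<le> M" unfolding P_def R_def M by (intro sum_mono; simp add: of_bool_def)+
  have nn: "P \<ge> 0" "R \<ge> 0" "D \<ge> 0" "E \<ge> 0"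
    unfolding P_def R_def D_def bad_count_def E_def by (intro sum_nonneg; simp)+
  have "D \<le> (\<Sum>z\<in>?X \<times> ?X \<times> ?X \<times> ?X. (\<lambda>(a, b, c, d). of_bool (1/2 < psi n f a b p) * of_bool (psi n f c d p < -1/2)) z)"
    unfolding D_def bad_count_def quads_def by (intro sum_mono) (auto simp: bad_quad_def)
  also have "\<dots> = (\<Sum>a\<in>?X. \<Sum>b\<in>?X. \<Sum>c\<in>?X. \<Sum>d\<in>?X. of_bool (1/2 < psi n f a b p) * of_bool (psi n f c d p < -1/2))"
    by (simp only: sum.cartesian_product)
  also have "\<dots> = P * R"
    by (simp only: P_def sum_distrib_right) (simp only: R_def sum_distrib_left)
  finally have DPR: "D \<le> P * R" .
  have fq: "f (p \<circ> transpose a b) = 0 \<or> f (p \<circ> transpose a b) = 1" if "a \<in> ?X" "b \<in> ?X" for a b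
    using f01 Sym_transpose[OF p that] by blast
  have far: "1 \<le> 4 * (x - y)\<^sup>2" if "1/2 \<le> \<bar>x - y\<bar>" for x y :: real
  proof -
    have "(1/2)\<^sup>2 \<le> \<bar>x - y\<bar>\<^sup>2" using that by (intro power_mono) auto
    then show ?thesis by (simp add: power2_eq_square)
  qed
  have min: "P \<le> 4 * E \<or> R \<le> 4 * E"
  proof (cases "f p = 1")
    case True
    have "R \<le> 4 * E" unfolding R_def E_def sum_distrib_left
    proof (intro sum_mono)
      fix a b assume "a \<in> ?X" "b \<in> ?X"
      then have "dif a b f p \<ge> 0" using fq[of a b] True by (auto simp: dif_def)
      then show "of_bool (psi n f a b p < -1/2) \<le> 4 * (dif a b f p - psi n f a b p)\<^sup>2"
        using far[of "dif a b f p" "psi n f a b p"] by auto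
    qed
    then show ?thesis ..
  next
    case False
    have "P \<le> 4 * E" unfolding P_def E_def sum_distrib_left
    proof (intro sum_mono)
      fix a b assume "a \<in> ?X" "b \<in> ?X"
      then have "dif a b f p \<le> 0" using fq[of a b] False f01[OF p] by (auto simp: dif_def)
      then show "of_bool (1/2 < psi n f a b p) \<le> 4 * (dif a b f p - psi n f a b p)\<^sup>2"
        using far[of "dif a b f p" "psi n f a b p"] by auto
    qed
    then show ?thesis ..
  qed
  \<comment> \<open>The weight stands in for a pointwise bound on \<open>M\<close>: it becomes
    negative once \<open>M\<close> exceeds \<open>48 * n\<close>, twice the conditional mean, and
    the claim is then trivial.\<close>
  have "D * (1 - M / (48 * real n)) \<le> 48 * real n * (4 * E)"
  proof (cases "M \<le> 48 * real n")
    case True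
    have "P * R \<le> M * (4 * E)"
      using min
    proof
      assume "P \<le> 4 * E"
      then have "P * R \<le> (4 * E) * M" using PM nn by (intro mult_mono) auto
      then show ?thesis by (simp add: mult.commute)
    next
      assume "R \<le> 4 * E"
      then show ?thesis using PM nn by (intro mult_mono) auto
    qed
    also have "\<dots> \<le> 48 * real n * (4 * E)" using True nn by (intro mult_right_mono) auto
    finally have "D \<le> 48 * real n * (4 * E)" using DPR by linarith
    moreover have "D * (1 - M / (48 * real n)) \<le> D * 1"
      using nn PM n by (intro mult_left_mono) auto
    ultimately show ?thesis by linarith
  next
    case False
    then have "1 - M / (48 * real n) \<le> 0" using n by (simp add: field_simps)
    then have "D * (1 - M / (48 * real n)) \<le> 0" using nn by (simp add: mult_nonneg_nonpos)
    moreover have "0 \<le> 48 * real n * (4 * E)" using nn by simp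
    ultimately show ?thesis by linarith
  qed
  then show ?thesis by (simp add: D_def M_def E_def)
qed

text \<open>The weights remove at most \<open>24 / 48\<close> of the total, so at least half of it
  survives and 192 doubles to 384.\<close>

lemma sum_bad_count_le:
  assumes n: "n \<ge> 20" and f01: "\<And>p. p \<in> Sym n \<Longrightarrow> f p = 0 \<or> f p = (1::real)"
    and small: "real (card (rects n f)) \<le> 8 * real n ^ 3"
  shows "(\<Sum>p\<in>Sym n. bad_count n f p)
    \<le> 384 * real n * (\<Sum>a\<in>{1..n}. \<Sum>b\<in>{1..n}. sq n (\<lambda>p. dif a b f p - psi n f a b p))"
proof -
  let ?X = "{1..n}"
  define D where "D = (\<Sum>p\<in>Sym n. bad_count n f p)"
  have n0: "n > 0" using n by simp
  have "D - (24 * real n * D) / (48 * real n) \<le> D - (\<Sum>p\<in>Sym n. bad_count n f p * heavy_count n f p) / (48 * real n)"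
    using sum_bad_count_mult_le[OF n small] by (intro diff_left_mono divide_right_mono) (auto simp: D_def)
  also have "\<dots> = (\<Sum>p\<in>Sym n. bad_count n f p * (1 - heavy_count n f p / (48 * real n)))"
    by (simp add: D_def sum_divide_distrib sum_subtractf right_diff_distrib)
  also have "\<dots> \<le> (\<Sum>p\<in>Sym n. 192 * real n * (\<Sum>a\<in>?X. \<Sum>b\<in>?X. (dif a b f p - psi n f a b p)\<^sup>2))"
    by (rule sum_mono, rule bad_count_mult_le[OF n0 _ f01])
  also have "\<dots> = 192 * real n * (\<Sum>a\<in>?X. \<Sum>b\<in>?X. sq n (\<lambda>p. dif a b f p - psi n f a b p))"
    unfolding sq_def sum_distrib_left[symmetric] by (simp only: sum.swap[of _ _ "Sym n"])
  finally show ?thesis using n0 by (simp add: D_def)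
qed

subsection \<open>Concentration of the rectangles on a line\<close>

text \<open>Rows are tagged with \<^const>\<open>Inl\<close> and columns with \<^const>\<open>Inr\<close>.\<close>

definition lines :: "nat \<times> nat \<times> nat \<times> nat \<Rightarrow> (nat + nat) set" where
  "lines = (\<lambda>(a, b, x, y). {Inl a, Inl b, Inr x, Inr y})"

definition flip :: "nat \<times> nat \<times> nat \<times> nat \<Rightarrow> nat \<times> nat \<times> nat \<times> nat" where
  "flip = (\<lambda>(a, b, x, y). (a, b, y, x))"

definition disjoint_pairs ::
  "(nat \<times> nat \<times> nat \<times> nat) set \<Rightarrow> (nat \<times> nat \<times> nat \<times> nat) set \<Rightarrow>
   ((nat \<times> nat \<times> nat \<times> nat) \<times> (nat \<times> nat \<times> nat \<times> nat)) set" where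
  "disjoint_pairs U V = {(R, R'). R \<in> U \<and> R' \<in> V \<and> lines R \<inter> lines R' = {}}"

definition fits :: "(nat \<Rightarrow> nat) \<Rightarrow> nat \<times> nat \<times> nat \<times> nat \<Rightarrow> bool" where
  "fits p = (\<lambda>(a, b, x, y). p a = x \<and> p b = y)"

lemma finite_disjoint_pairs: "finite U \<Longrightarrow> finite V \<Longrightarrow> finite (disjoint_pairs U V)"
  by (rule finite_subset[of _ "U \<times> V"]) (auto simp: disjoint_pairs_def)

lemma finite_pos_neg_rects [simp]: "finite (pos_rects n g)" "finite (neg_rects n g)"
  using finite_rects[of n g] by (simp_all add: rects_def)

text \<open>Disjoint rectangles prescribe four distinct values at four distinct positions.\<close>

lemma card_fits_both:
  assumes "z \<in> disjoint_pairs (pos_rects n g) (neg_rects n g)"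
  shows "card {p \<in> Sym n. fits p (fst z) \<and> fits p (snd z)} = fact (n - 4)"
proof -
  obtain a b x y c d u v where z: "z = ((a, b, x, y), (c, d, u, v))" by (metis prod.exhaust)
  have 1: "(a, b, x, y) \<in> rects n g" "(c, d, u, v) \<in> rects n g"
    and dj: "{Inl a, Inl b, Inr x, Inr y} \<inter> {Inl c, Inl d, Inr u, Inr v} = ({} :: (nat + nat) set)"
    using assms by (auto simp: z disjoint_pairs_def rects_def lines_def)
  note m = rectsD[OF 1(1)] rectsD[OF 1(2)]
  have ne: "a \<noteq> c" "a \<noteq> d" "b \<noteq> c" "b \<noteq> d" "x \<noteq> u" "x \<noteq> v" "y \<noteq> u" "y \<noteq> v" using dj by auto
  let ?K = "{a, b, c, d}"
  let ?\<phi> = "\<lambda>i. if i = a then x else if i = b then y else if i = c then u else v"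
  have cK: "card ?K = 4" using m ne by simp
  have "{p \<in> Sym n. fits p (fst z) \<and> fits p (snd z)} = {p. p permutes {1..n} \<and> (\<forall>i\<in>?K. p i = ?\<phi> i)}"
    using m ne by (auto simp: z fits_def Sym_def)
  also have "card \<dots> = fact (card {1..n} - card ?K)"
    by (rule card_permutes_extending) (use m ne in \<open>auto simp: inj_on_def simp del: atLeastAtMost_iff\<close>)
  finally show ?thesis by (simp add: cK)
qed

text \<open>Double counting of pairs against permutations: given \<open>p\<close>, a pair that fits
  \<open>p\<close> is recovered from its four positions, which form a bad quadruple.\<close>

lemma card_disjoint_pairs_le_bad_count:
  "fact (n - 4) * real (card (disjoint_pairs (pos_rects n g) (neg_rects n g))) \<le> (\<Sum>p\<in>Sym n. bad_count n g p)"
proof -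
  let ?Z = "disjoint_pairs (pos_rects n g) (neg_rects n g)"
  have fin: "finite ?Z" by (intro finite_disjoint_pairs) auto
  have "fact (n - 4) * real (card ?Z) = (\<Sum>z\<in>?Z. real (card {p \<in> Sym n. fits p (fst z) \<and> fits p (snd z)}))"
    by (simp add: card_fits_both)
  also have "\<dots> = (\<Sum>z\<in>?Z. \<Sum>p\<in>Sym n. of_bool (fits p (fst z) \<and> fits p (snd z)))"
    by (rule sum.cong[OF refl]) (simp add: Int_def)
  also have "\<dots> = (\<Sum>p\<in>Sym n. \<Sum>z\<in>?Z. of_bool (fits p (fst z) \<and> fits p (snd z)))"
    by (rule sum.swap)
  also have "\<dots> \<le> (\<Sum>p\<in>Sym n. bad_count n g p)"
  proof (rule sum_mono)
    fix p assume p: "p \<in> Sym n"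
    let ?F = "{z \<in> ?Z. fits p (fst z) \<and> fits p (snd z)}"
    let ?h = "\<lambda>z::(nat \<times> nat \<times> nat \<times> nat) \<times> (nat \<times> nat \<times> nat \<times> nat).
      (fst (fst z), fst (snd (fst z)), fst (snd z), fst (snd (snd z)))"
    have "card ?F \<le> card {q \<in> quads n. bad_quad n g p q}"
    proof (rule card_inj_on_le[of ?h])
      show "inj_on ?h ?F" by (rule inj_onI) (auto simp: fits_def)
      show "?h ` ?F \<subseteq> {q \<in> quads n. bad_quad n g p q}"
      proof (rule image_subsetI)
        fix z assume zF: "z \<in> ?F"
        obtain a b x y c d u v where z: "z = ((a, b, x, y), (c, d, u, v))" by (metis prod.exhaust)
        have xy: "x = p a" "y = p b" "u = p c" "v = p d" using zF by (auto simp: z fits_def)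
        have P: "(a, b, p a, p b) \<in> pos_rects n g" and N: "(c, d, p c, p d) \<in> neg_rects n g"
          and dj: "lines (a, b, x, y) \<inter> lines (c, d, u, v) = {}"
          using zF by (auto simp: z xy disjoint_pairs_def)
        have m: "a \<in> {1..n}" "b \<in> {1..n}" "c \<in> {1..n}" "d \<in> {1..n}"
          using rectsD(1,2)[of a b "p a" "p b" n g] rectsD(1,2)[of c d "p c" "p d" n g] P N by (simp_all add: rects_def)
        show "?h z \<in> {q \<in> quads n. bad_quad n g p q}"
          using P N dj m unfolding rects_iff(1)[OF p m(1,2)] rects_iff(2)[OF p m(3,4)]
          by (auto simp: z quads_def bad_quad_def lines_def)
      qed
    qed simp
    moreover have "?Z \<inter> {z. fits p (fst z) \<and> fits p (snd z)} = ?F" by auto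
    moreover have "quads n \<inter> {q. bad_quad n g p q} = {q \<in> quads n. bad_quad n g p q}" by auto
    ultimately show "(\<Sum>z\<in>?Z. of_bool (fits p (fst z) \<and> fits p (snd z))) \<le> bad_count n g p"
      using fin by (simp add: bad_count_def)
  qed
  finally show ?thesis .
qed

lemma flip_rects: "flip R \<in> neg_rects n g \<longleftrightarrow> R \<in> pos_rects n g" "flip R \<in> pos_rects n g \<longleftrightarrow> R \<in> neg_rects n g"
proof -
  obtain a b x y where R: "R = (a, b, x, y)" by (metis prod.exhaust)
  show "flip R \<in> neg_rects n g \<longleftrightarrow> R \<in> pos_rects n g" "flip R \<in> pos_rects n g \<longleftrightarrow> R \<in> neg_rects n g"
    by (simp_all add: R flip_def rects_flip[symmetric])
qed

lemma lines_flip [simp]: "lines (flip R) = lines R"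
  by (cases R) (auto simp: lines_def flip_def)

lemma flip_flip [simp]: "flip (flip R) = R"
  by (cases R) (auto simp: flip_def)

text \<open>\<open>flip\<close> reverses the sign of a rectangle and keeps its lines, so every
  disjoint pair comes from one of signs plus and minus, in one of four ways.\<close>

lemma card_disjoint_rects_le:
  "card (disjoint_pairs (rects n g) (rects n g)) \<le> 4 * card (disjoint_pairs (pos_rects n g) (neg_rects n g))"
proof -
  let ?Z = "disjoint_pairs (pos_rects n g) (neg_rects n g)"
  have fin: "finite ?Z" by (intro finite_disjoint_pairs) auto
  let ?g1 = "\<lambda>z. (snd z, fst z)" and ?g2 = "\<lambda>z. (fst z, flip (snd z))" and ?g3 = "\<lambda>z. (flip (fst z), snd z)"
  have "disjoint_pairs (rects n g) (rects n g) \<subseteq> (?Z \<union> ?g1 ` ?Z) \<union> (?g2 ` ?Z \<union> ?g3 ` ?Z)"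
  proof
    fix z assume "z \<in> disjoint_pairs (rects n g) (rects n g)"
    then obtain R R' where z: "z = (R, R')" "R \<in> rects n g" "R' \<in> rects n g" and dj: "lines R \<inter> lines R' = {}"
      by (auto simp: disjoint_pairs_def)
    from z(2,3) consider "R \<in> pos_rects n g" "R' \<in> neg_rects n g" | "R \<in> neg_rects n g" "R' \<in> pos_rects n g"
      | "R \<in> pos_rects n g" "R' \<in> pos_rects n g" | "R \<in> neg_rects n g" "R' \<in> neg_rects n g"
      by (auto simp: rects_def)
    then show "z \<in> (?Z \<union> ?g1 ` ?Z) \<union> (?g2 ` ?Z \<union> ?g3 ` ?Z)"
    proof cases
      case 1
      then have "(R, R') \<in> ?Z" using dj by (simp add: disjoint_pairs_def)
      then show ?thesis by (simp add: z)
    next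
      case 2
      then have "(R', R) \<in> ?Z" using dj by (auto simp: disjoint_pairs_def)
      then have "?g1 (R', R) \<in> ?g1 ` ?Z" by (rule imageI)
      then show ?thesis by (simp add: z)
    next
      case 3
      then have "(R, flip R') \<in> ?Z" using dj by (simp add: disjoint_pairs_def flip_rects)
      then have "?g2 (R, flip R') \<in> ?g2 ` ?Z" by (rule imageI)
      then show ?thesis by (simp add: z)
    next
      case 4
      then have "(flip R, R') \<in> ?Z" using dj by (simp add: disjoint_pairs_def flip_rects)
      then have "?g3 (flip R, R') \<in> ?g3 ` ?Z" by (rule imageI)
      then show ?thesis by (simp add: z)
    qed
  qed
  then have "card (disjoint_pairs (rects n g) (rects n g)) \<le> card ((?Z \<union> ?g1 ` ?Z) \<union> (?g2 ` ?Z \<union> ?g3 ` ?Z))"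
    by (rule card_mono[rotated]) (use fin in simp)
  also have "\<dots> \<le> (card ?Z + card (?g1 ` ?Z)) + (card (?g2 ` ?Z) + card (?g3 ` ?Z))"
    by (intro order_trans[OF card_Un_le] add_mono card_Un_le)
  also have "\<dots> \<le> (card ?Z + card ?Z) + (card ?Z + card ?Z)"
    by (intro add_mono card_image_le fin order_refl)
  finally show ?thesis by simp
qed

lemma fact_le_power4: "n \<ge> 4 \<Longrightarrow> (fact n :: real) \<le> real n ^ 4 * fact (n - 4)"
proof -
  assume "n \<ge> 4"
  then obtain m where n: "n = Suc (Suc (Suc (Suc m)))" using Nat.le_Suc_ex[of 4 n] by (auto simp: numeral_eq_Suc)
  have "(fact n :: real) = (real n * ((real n - 1) * ((real n - 2) * (real n - 3)))) * fact (n - 4)"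
    by (simp add: n algebra_simps)
  also have "\<dots> \<le> (real n * (real n * (real n * real n))) * fact (n - 4)"
    using \<open>n \<ge> 4\<close> by (intro mult_right_mono mult_mono) auto
  finally show ?thesis by (simp add: power4_eq_xxxx mult.assoc)
qed

text \<open>The constant is \<open>4 * 384 * 16\<close>: sign patterns, bad quadruples, error bound.
  For comparison, \<open>small\<close> allows \<open>64 * n ^ 6\<close> pairs altogether.\<close>

lemma card_disjoint_rects_bound:
  assumes n: "n \<ge> 20" and f01: "\<And>p. p \<in> Sym n \<Longrightarrow> f p = 0 \<or> f p = (1::real)"
    and small: "real (card (rects n f)) \<le> 8 * real n ^ 3"
    and err: "(\<Sum>a\<in>{1..n}. \<Sum>b\<in>{1..n}. sq n (\<lambda>p. dif a b f p - psi n f a b p)) \<le> 16 * real n * fact n * \<eta>"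
    and \<eta>: "\<eta> \<ge> 0"
  shows "real (card (disjoint_pairs (rects n f) (rects n f))) \<le> 24576 * \<eta> * real n ^ 6"
proof -
  let ?c = "real (card (disjoint_pairs (rects n f) (rects n f)))"
  have "fact (n - 4) * ?c \<le> fact (n - 4) * (4 * real (card (disjoint_pairs (pos_rects n f) (neg_rects n f))))"
    using card_disjoint_rects_le[of n f] by (intro mult_left_mono) auto
  also have "\<dots> \<le> 4 * (\<Sum>p\<in>Sym n. bad_count n f p)"
    using card_disjoint_pairs_le_bad_count[of n f] by simp
  also have "\<dots> \<le> 4 * (384 * real n * (16 * real n * fact n * \<eta>))"
  proof -
    have "384 * real n * (\<Sum>a\<in>{1..n}. \<Sum>b\<in>{1..n}. sq n (\<lambda>p. dif a b f p - psi n f a b p))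
        \<le> 384 * real n * (16 * real n * fact n * \<eta>)"
      using err by (intro mult_left_mono) auto
    then show ?thesis using sum_bad_count_le[OF n f01 small] by simp
  qed
  also have "\<dots> = 24576 * real n ^ 2 * \<eta> * fact n" by (simp add: power2_eq_square)
  also have "\<dots> \<le> 24576 * real n ^ 2 * \<eta> * (real n ^ 4 * fact (n - 4))"
    using n \<eta> by (intro mult_left_mono fact_le_power4) auto
  also have "\<dots> = fact (n - 4) * (24576 * \<eta> * (real n ^ 2 * real n ^ 4))" by (simp only: mult_ac)
  finally have "?c \<le> 24576 * \<eta> * (real n ^ 2 * real n ^ 4)"
    by (rule mult_left_le_imp_le) simp
  then show ?thesis by (simp flip: power_add)
qed

section \<open>Rectangles through prescribed lines\<close>

lemma card_through_line:
  assumes Z: "Z \<subseteq> quads n"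
  shows "card {R \<in> Z. l \<in> lines R} \<le> 2 * n ^ 3"
proof -
  let ?X = "{1..n}"
  obtain A B where AB: "{R \<in> Z. l \<in> lines R} \<subseteq> A \<union> B" "finite A" "finite B" "card A = n ^ 3" "card B = n ^ 3"
  proof (cases l)
    case (Inl a)
    show ?thesis
      by (rule that[of "{a} \<times> ?X \<times> ?X \<times> ?X" "?X \<times> {a} \<times> ?X \<times> ?X"])
         (use Z in \<open>auto simp: Inl lines_def quads_def card_cartesian_product power3_eq_cube\<close>)
  next
    case (Inr a)
    show ?thesis
      by (rule that[of "?X \<times> ?X \<times> {a} \<times> ?X" "?X \<times> ?X \<times> ?X \<times> {a}"])
         (use Z in \<open>auto simp: Inr lines_def quads_def card_cartesian_product power3_eq_cube\<close>)
  qed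
  have "card {R \<in> Z. l \<in> lines R} \<le> card (A \<union> B)" using AB by (intro card_mono) auto
  also have "\<dots> \<le> card A + card B" by (rule card_Un_le)
  finally show ?thesis using AB by simp
qed

lemma card_through_two_lines:
  assumes Z: "Z \<subseteq> quads n" and lm: "l \<noteq> m"
  shows "card {R \<in> Z. l \<in> lines R \<and> m \<in> lines R} \<le> 4 * n ^ 2"
proof -
  let ?X = "{1..n}"
  have main: "card {R \<in> Z. l \<in> lines R \<and> m \<in> lines R} \<le> 4 * n ^ 2"
    if "{R \<in> Z. l \<in> lines R \<and> m \<in> lines R} \<subseteq> A \<union> B \<union> (C \<union> D)" "finite A" "finite B" "finite C" "finite D"
      "card A = n ^ 2" "card B = n ^ 2" "card C = n ^ 2" "card D = n ^ 2" for A B C D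
  proof -
    have "card {R \<in> Z. l \<in> lines R \<and> m \<in> lines R} \<le> card (A \<union> B \<union> (C \<union> D))" using that by (intro card_mono) auto
    also have "\<dots> \<le> (card A + card B) + (card C + card D)" by (intro order_trans[OF card_Un_le] add_mono card_Un_le)
    finally show ?thesis using that by simp
  qed
  have lr: "card {R \<in> Z. Inl a \<in> lines R \<and> Inr x \<in> lines R} \<le> 4 * n ^ 2" if "{l, m} = {Inl a, Inr x}" for a x
  proof -
    have "{R \<in> Z. l \<in> lines R \<and> m \<in> lines R} = {R \<in> Z. Inl a \<in> lines R \<and> Inr x \<in> lines R}"
      using that by (auto simp: doubleton_eq_iff)
    moreover have "card {R \<in> Z. l \<in> lines R \<and> m \<in> lines R} \<le> 4 * n ^ 2"
      by (rule main[of "{a} \<times> ?X \<times> {x} \<times> ?X" "{a} \<times> ?X \<times> ?X \<times> {x}" "?X \<times> {a} \<times> {x} \<times> ?X" "?X \<times> {a} \<times> ?X \<times> {x}"])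
         (use Z that in \<open>auto simp: doubleton_eq_iff lines_def quads_def card_cartesian_product power2_eq_square\<close>)
    ultimately show ?thesis by simp
  qed
  show ?thesis
  proof (cases l; cases m)
    \<comment> \<open>Two rows allow only two shapes; each is listed twice to match the four sets of
      \<open>main\<close>.\<close>
    fix a b assume "l = Inl a" "m = Inl b"
    then show ?thesis using lm Z
      by (intro main[of "{a} \<times> {b} \<times> ?X \<times> ?X" "{b} \<times> {a} \<times> ?X \<times> ?X" "{a} \<times> {b} \<times> ?X \<times> ?X" "{b} \<times> {a} \<times> ?X \<times> ?X"])
         (auto simp: lines_def quads_def card_cartesian_product power2_eq_square)
  next
    fix a b assume "l = Inr a" "m = Inr b"
    then show ?thesis using lm Z
      by (intro main[of "?X \<times> ?X \<times> {a} \<times> {b}" "?X \<times> ?X \<times> {b} \<times> {a}" "?X \<times> ?X \<times> {a} \<times> {b}" "?X \<times> ?X \<times> {b} \<times> {a}"])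
         (auto simp: lines_def quads_def card_cartesian_product power2_eq_square)
  next
    fix a b assume "l = Inl a" "m = Inr b"
    then show ?thesis using lr[of a b] by simp
  next
    fix a b assume "l = Inr a" "m = Inl b"
    then show ?thesis using lr[of b a] by (simp add: insert_commute conj_commute)
  qed
qed

lemma finite_lines [simp]: "finite (lines R)"
  by (cases R) (simp add: lines_def)

lemma card_lines_le: "card (lines R) \<le> 4"
  by (cases R) (simp add: lines_def card_insert_if)

text \<open>Pair the rectangles through \<open>l\<close> only with those through \<open>m\<close>
  only. Such a pair is disjoint or meets in a further line, the latter at most
  \<open>2 * n ^ 3 * (4 * 4 * n ^ 2)\<close> times. Since \<open>m\<close> carries at least as many
  rectangles as \<open>l\<close>, the first family is the smaller one and its square is
  bounded.\<close>

lemma card_only_line_le: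
  assumes Z: "Z \<subseteq> quads n" and lm: "l \<noteq> m"
    and le: "card {R \<in> Z. l \<in> lines R} \<le> card {R \<in> Z. m \<in> lines R}"
  shows "(card {R \<in> Z. l \<in> lines R \<and> m \<notin> lines R})\<^sup>2 \<le> card (disjoint_pairs Z Z) + 32 * n ^ 5"
proof -
  let ?A = "{R \<in> Z. l \<in> lines R \<and> m \<notin> lines R}" and ?B = "{R \<in> Z. m \<in> lines R \<and> l \<notin> lines R}"
  let ?C = "{R \<in> Z. l \<in> lines R \<and> m \<in> lines R}"
  have finZ: "finite Z" using Z finite_quads by (rule finite_subset)
  have "card {R \<in> Z. l \<in> lines R} = card ?A + card ?C"
    using finZ by (subst card_Un_disjoint[symmetric]) (auto intro: arg_cong[where f=card])
  moreover have "card {R \<in> Z. m \<in> lines R} = card ?B + card ?C"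
    using finZ by (subst card_Un_disjoint[symmetric]) (auto intro: arg_cong[where f=card])
  ultimately have AB: "card ?A \<le> card ?B" using le by linarith
  define T where "T R = (\<Union>k\<in>lines R - {m}. {R' \<in> Z. m \<in> lines R' \<and> k \<in> lines R'})" for R
  have "?A \<times> ?B \<subseteq> disjoint_pairs Z Z \<union> (SIGMA R:{R \<in> Z. l \<in> lines R}. T R)"
    by (auto simp: disjoint_pairs_def T_def)
  then have "card (?A \<times> ?B) \<le> card (disjoint_pairs Z Z \<union> (SIGMA R:{R \<in> Z. l \<in> lines R}. T R))"
    by (rule card_mono[rotated]) (use finZ in \<open>auto simp: T_def intro!: finite_disjoint_pairs\<close>)
  also have "\<dots> \<le> card (disjoint_pairs Z Z) + card (SIGMA R:{R \<in> Z. l \<in> lines R}. T R)"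
    by (rule card_Un_le)
  also have "card (SIGMA R:{R \<in> Z. l \<in> lines R}. T R) = (\<Sum>R\<in>{R \<in> Z. l \<in> lines R}. card (T R))"
    using finZ by (intro card_SigmaI) (auto simp: T_def)
  also have "\<dots> \<le> (\<Sum>R\<in>{R \<in> Z. l \<in> lines R}. 16 * n ^ 2)"
  proof (rule sum_mono)
    fix R
    have "card (T R) \<le> (\<Sum>k\<in>lines R - {m}. card {R' \<in> Z. m \<in> lines R' \<and> k \<in> lines R'})"
      unfolding T_def by (rule card_UN_le) simp
    also have "\<dots> \<le> (\<Sum>k\<in>lines R - {m}. 4 * n ^ 2)"
      by (intro sum_mono card_through_two_lines[OF Z]) auto
    also have "\<dots> = card (lines R - {m}) * (4 * n ^ 2)" by simp
    also have "\<dots> \<le> 4 * (4 * n ^ 2)"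
      using card_lines_le[of R] card_mono[of "lines R" "lines R - {m}"] by (intro mult_right_mono) auto
    finally show "card (T R) \<le> 16 * n ^ 2" by simp
  qed
  also have "\<dots> = card {R \<in> Z. l \<in> lines R} * (16 * n ^ 2)" by simp
  also have "\<dots> \<le> 2 * n ^ 3 * (16 * n ^ 2)" by (intro mult_right_mono card_through_line[OF Z]) simp
  also have "\<dots> = 32 * n ^ 5" by (simp flip: power_add)
  finally have "card ?A * card ?B \<le> card (disjoint_pairs Z Z) + 32 * n ^ 5"
    by (simp add: card_cartesian_product)
  moreover have "(card ?A)\<^sup>2 \<le> card ?A * card ?B" unfolding power2_eq_square using AB by (rule mult_left_mono) simp
  ultimately show ?thesis by linarith
qed

text \<open>Some rectangle \<open>R\<close> meets nearly all of \<open>Z\<close>. Among the four lines of \<open>R\<close> no two can both carry a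
  large part of \<open>Z\<close>, since rectangles through different lines are typically disjoint.\<close>

lemma concentrated_on_line:
  assumes Z: "Z \<subseteq> quads n" and n: "n > 0"
    and B: "B \<ge> 0" "real (card (disjoint_pairs Z Z)) \<le> B\<^sup>2"
  shows "\<exists>l \<in> Inl ` {1..n} \<union> Inr ` {1..n}. real (card {R \<in> Z. l \<notin> lines R}) \<le> B + 3 * sqrt (B\<^sup>2 + 32 * real n ^ 5)"
proof (cases "real (card Z) \<le> B")
  case True
  have finZ: "finite Z" using Z finite_quads by (rule finite_subset)
  \<comment> \<open>With so few rectangles any line will do.\<close>
  have "card {R \<in> Z. Inl 1 \<notin> lines R} \<le> card Z" using finZ by (intro card_mono) auto
  then have "real (card {R \<in> Z. Inl 1 \<notin> lines R}) \<le> B" using True by linarith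
  moreover have "0 \<le> 3 * sqrt (B\<^sup>2 + 32 * real n ^ 5)" by simp
  ultimately have "real (card {R \<in> Z. Inl 1 \<notin> lines R}) \<le> B + 3 * sqrt (B\<^sup>2 + 32 * real n ^ 5)" by linarith
  moreover have "Inl 1 \<in> Inl ` {1..n} \<union> Inr ` {1..n}" using n by auto
  ultimately show ?thesis by blast
next
  case False
  have finZ: "finite Z" using Z finite_quads by (rule finite_subset)
  define dg where "dg R = card {R' \<in> Z. lines R \<inter> lines R' = {}}" for R
  have Zne: "Z \<noteq> {}" using False B by auto
  \<comment> \<open>\<open>R\<close> misses the fewest rectangles. By averaging it misses at most
    \<open>B^2 / card Z\<close> of them, which is at most \<open>B\<close> because
    \<open>card Z\<close> exceeds \<open>B\<close>.\<close>
  then obtain R where R: "R \<in> Z" "\<And>R'. R' \<in> Z \<Longrightarrow> dg R \<le> dg R'"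
    using arg_min_if_finite[OF finZ, of dg] by (metis linorder_not_less)
  have dp: "disjoint_pairs Z Z = (SIGMA R:Z. {R' \<in> Z. lines R \<inter> lines R' = {}})" by (auto simp: disjoint_pairs_def)
  have "card Z * dg R = (\<Sum>R'\<in>Z. dg R)" by simp
  also have "\<dots> \<le> (\<Sum>R'\<in>Z. dg R')" using R by (intro sum_mono) auto
  also have "\<dots> = card (disjoint_pairs Z Z)"
    unfolding dp dg_def using finZ by (intro card_SigmaI[symmetric]) auto
  finally have "real (card Z) * real (dg R) \<le> B\<^sup>2" using B(2) by (metis (no_types) of_nat_le_iff of_nat_mult order_trans)
  moreover have "B * real (dg R) \<le> real (card Z) * real (dg R)" using False by (intro mult_right_mono) auto
  ultimately have "B * real (dg R) \<le> B * B" by (simp add: power2_eq_square)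
  then have dgB: "real (dg R) \<le> B"
  proof (cases "B = 0")
    case True
    then have "real (card Z) * real (dg R) \<le> 0" using \<open>real (card Z) * real (dg R) \<le> B\<^sup>2\<close> by simp
    moreover have "real (card Z) > 0" using Zne finZ by (simp add: card_gt_0_iff)
    ultimately show ?thesis using True by (simp add: mult_le_0_iff)
  qed (use B in auto)
  have Lne: "lines R \<noteq> {}" by (cases R) (simp add: lines_def)
  \<comment> \<open>The heaviest line of \<open>R\<close>, because \<open>card_only_line_le\<close>
    compares a line with one at least as heavy. A rectangle off \<open>l\<close> is disjoint from
    \<open>R\<close> or uses one of the other three lines.\<close>
  obtain l where l: "l \<in> lines R" "\<And>k. k \<in> lines R \<Longrightarrow> card {R \<in> Z. k \<in> lines R} \<le> card {R \<in> Z. l \<in> lines R}"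
  proof -
    have "\<exists>l\<in>lines R. \<forall>k\<in>lines R. card {R \<in> Z. k \<in> lines R} \<le> card {R \<in> Z. l \<in> lines R}"
      using Max_in[of "(\<lambda>k. card {R \<in> Z. k \<in> lines R}) ` lines R"] Max_ge[of "(\<lambda>k. card {R \<in> Z. k \<in> lines R}) ` lines R"] Lne
      by fastforce
    then show ?thesis using that by blast
  qed
  have "{R' \<in> Z. l \<notin> lines R'} \<subseteq> {R' \<in> Z. lines R \<inter> lines R' = {}} \<union>
      (\<Union>k\<in>lines R - {l}. {R' \<in> Z. k \<in> lines R' \<and> l \<notin> lines R'})" by auto
  then have "card {R' \<in> Z. l \<notin> lines R'} \<le> card ({R' \<in> Z. lines R \<inter> lines R' = {}} \<union>
      (\<Union>k\<in>lines R - {l}. {R' \<in> Z. k \<in> lines R' \<and> l \<notin> lines R'}))"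
    by (rule card_mono[rotated]) (use finZ in auto)
  also have "\<dots> \<le> dg R + card (\<Union>k\<in>lines R - {l}. {R' \<in> Z. k \<in> lines R' \<and> l \<notin> lines R'})"
    unfolding dg_def by (rule card_Un_le)
  also have "\<dots> \<le> dg R + (\<Sum>k\<in>lines R - {l}. card {R' \<in> Z. k \<in> lines R' \<and> l \<notin> lines R'})"
    by (intro add_left_mono card_UN_le) simp
  finally have "real (card {R' \<in> Z. l \<notin> lines R'}) \<le>
      real (dg R + (\<Sum>k\<in>lines R - {l}. card {R' \<in> Z. k \<in> lines R' \<and> l \<notin> lines R'}))"
    by (simp only: of_nat_le_iff)
  also have "\<dots> = real (dg R) + (\<Sum>k\<in>lines R - {l}. real (card {R' \<in> Z. k \<in> lines R' \<and> l \<notin> lines R'}))"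
    by (simp only: of_nat_add of_nat_sum)
  also have "\<dots> \<le> B + (\<Sum>k\<in>lines R - {l}. sqrt (B\<^sup>2 + 32 * real n ^ 5))"
  proof (intro add_mono dgB sum_mono)
    fix k assume k: "k \<in> lines R - {l}"
    have "(card {R' \<in> Z. k \<in> lines R' \<and> l \<notin> lines R'})\<^sup>2 \<le> card (disjoint_pairs Z Z) + 32 * n ^ 5"
      using k l by (intro card_only_line_le[OF Z]) auto
    then have "real ((card {R' \<in> Z. k \<in> lines R' \<and> l \<notin> lines R'})\<^sup>2) \<le> real (card (disjoint_pairs Z Z) + 32 * n ^ 5)"
      by (simp only: of_nat_le_iff)
    then have "(real (card {R' \<in> Z. k \<in> lines R' \<and> l \<notin> lines R'}))\<^sup>2 \<le> B\<^sup>2 + 32 * real n ^ 5"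
      using B(2) by simp
    then show "real (card {R' \<in> Z. k \<in> lines R' \<and> l \<notin> lines R'}) \<le> sqrt (B\<^sup>2 + 32 * real n ^ 5)"
      by (rule real_le_rsqrt)
  qed
  also have "\<dots> = B + real (card (lines R - {l})) * sqrt (B\<^sup>2 + 32 * real n ^ 5)" by simp
  also have "\<dots> \<le> B + 3 * sqrt (B\<^sup>2 + 32 * real n ^ 5)"
  proof -
    have "card (lines R - {l}) = card (lines R) - 1" using l by simp
    then have "card (lines R - {l}) \<le> 3" using card_lines_le[of R] by linarith
    then show ?thesis by (intro add_left_mono mult_right_mono) auto
  qed
  finally have "real (card {R' \<in> Z. l \<notin> lines R'}) \<le> B + 3 * sqrt (B\<^sup>2 + 32 * real n ^ 5)" .
  moreover have "l \<in> Inl ` {1..n} \<union> Inr ` {1..n}"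
  proof -
    have "R \<in> quads n" using Z R(1) by blast
    then show ?thesis using l(1) by (cases R) (auto simp: lines_def quads_def)
  qed
  ultimately show ?thesis by blast
qed

subsection \<open>Rounding to a dictatorship\<close>

text \<open>Differences of a Boolean function are 0 or 1 in absolute value. Where \<open>psi\<close>
  is at most 1/2 in absolute value, such a difference is at most twice its error; elsewhere a
  rectangle pays for it.\<close>

lemma sum_restricted_dif_le:
  assumes f01: "\<And>p. p \<in> Sym n \<Longrightarrow> f p = 0 \<or> f p = (1::real)"
  shows "(\<Sum>a\<in>{1..n}. \<Sum>b\<in>{1..n}. \<Sum>p\<in>Sym n. of_bool (Q (a, b, p a, p b)) * (dif a b f p)\<^sup>2)
    \<le> fact (n - 2) * real (card {R \<in> rects n f. Q R})
      + 4 * (\<Sum>a\<in>{1..n}. \<Sum>b\<in>{1..n}. sq n (\<lambda>p. dif a b f p - psi n f a b p))"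
proof -
  let ?X = "{1..n}"
  have "(\<Sum>a\<in>?X. \<Sum>b\<in>?X. \<Sum>p\<in>Sym n. of_bool (Q (a, b, p a, p b)) * (dif a b f p)\<^sup>2) \<le>
    (\<Sum>a\<in>?X. \<Sum>b\<in>?X. \<Sum>p\<in>Sym n. of_bool ((a, b, p a, p b) \<in> rects n f \<and> Q (a, b, p a, p b))
       + 4 * (dif a b f p - psi n f a b p)\<^sup>2)"
  proof (intro sum_mono)
    fix a b p assume ab: "a \<in> ?X" "b \<in> ?X" and p: "p \<in> Sym n"
    have d: "dif a b f p = 0 \<or> \<bar>dif a b f p\<bar> = 1"
      using f01[OF p] f01[OF Sym_transpose[OF p ab]] by (auto simp: dif_def)
    have "(dif a b f p)\<^sup>2 \<le> 4 * (dif a b f p - psi n f a b p)\<^sup>2" if "\<not> 1/2 < \<bar>psi n f a b p\<bar>"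
    proof -
      have "\<bar>dif a b f p\<bar> \<le> \<bar>2 * (dif a b f p - psi n f a b p)\<bar>" using d that by auto
      then have "\<bar>dif a b f p\<bar>\<^sup>2 \<le> \<bar>2 * (dif a b f p - psi n f a b p)\<bar>\<^sup>2" by (intro power_mono) auto
      then show ?thesis unfolding power2_abs power_mult_distrib by simp
    qed
    moreover have "(dif a b f p)\<^sup>2 \<le> 1" unfolding abs_square_le_1 using d by auto
    moreover have "0 \<le> 4 * (dif a b f p - psi n f a b p)\<^sup>2" by simp
    ultimately show "of_bool (Q (a, b, p a, p b)) * (dif a b f p)\<^sup>2 \<le>
        of_bool ((a, b, p a, p b) \<in> rects n f \<and> Q (a, b, p a, p b)) + 4 * (dif a b f p - psi n f a b p)\<^sup>2"
      unfolding rects_iff(3)[OF p ab] by (auto simp: of_bool_def intro: add_increasing2)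
  qed
  also have "\<dots> = (\<Sum>a\<in>?X. \<Sum>b\<in>?X. \<Sum>p\<in>Sym n. of_bool ((a, b, p a, p b) \<in> rects n f \<and> Q (a, b, p a, p b)))
      + 4 * (\<Sum>a\<in>?X. \<Sum>b\<in>?X. sq n (\<lambda>p. dif a b f p - psi n f a b p))"
    by (simp only: sum.distrib sum_distrib_left sq_def)
  finally show ?thesis unfolding sum_rects .
qed

lemma ener_row:
  "ener n ({1..n} - {i}) f = (\<Sum>a\<in>{1..n}. \<Sum>b\<in>{1..n}. \<Sum>p\<in>Sym n.
     of_bool (Inl i \<notin> lines (a, b, p a, p b)) * (dif a b f p)\<^sup>2)"
proof -
  let ?X = "{1..n}"
  have "ener n (?X - {i}) f = (\<Sum>a\<in>?X - {i}. \<Sum>b\<in>?X. \<Sum>p\<in>Sym n. of_bool (Inl i \<notin> lines (a, b, p a, p b)) * (dif a b f p)\<^sup>2)"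
    unfolding ener_def sq_def
    by (rule sum.cong[OF refl], rule sum.mono_neutral_cong_left) (auto simp: lines_def)
  also have "\<dots> = (\<Sum>a\<in>?X. \<Sum>b\<in>?X. \<Sum>p\<in>Sym n. of_bool (Inl i \<notin> lines (a, b, p a, p b)) * (dif a b f p)\<^sup>2)"
    by (rule sum.mono_neutral_left) (auto simp: lines_def)
  finally show ?thesis .
qed

lemma sum_Sym_inv: "(\<Sum>p\<in>Sym n. g (inv p)) = (\<Sum>p\<in>Sym n. g p)"
  unfolding Sym_def by (rule sum_permutations_inverse[symmetric])

text \<open>Inversion exchanges rows and columns, so the gap for positions, applied to
  \<open>f (inv p)\<close>, also serves the column case.\<close>

lemma ener_column:
  "ener n ({1..n} - {j}) (\<lambda>p. f (inv p)) = (\<Sum>a\<in>{1..n}. \<Sum>b\<in>{1..n}. \<Sum>p\<in>Sym n.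
     of_bool (Inr j \<notin> lines (a, b, p a, p b)) * (dif a b f p)\<^sup>2)"
proof -
  let ?X = "{1..n}"
  let ?H = "\<lambda>p x y. of_bool (x \<noteq> j \<and> y \<noteq> j) * (f p - f (transpose x y \<circ> p))\<^sup>2"
  have sqc: "sq n (dif x y (\<lambda>p. f (inv p))) = (\<Sum>p\<in>Sym n. (f p - f (transpose x y \<circ> p))\<^sup>2)" for x y
  proof -
    have "sq n (dif x y (\<lambda>p. f (inv p))) = (\<Sum>p\<in>Sym n. (dif x y (\<lambda>p. f (inv p)) (inv p))\<^sup>2)"
      unfolding sq_def by (rule sum_Sym_inv[symmetric])
    also have "\<dots> = (\<Sum>p\<in>Sym n. (f p - f (transpose x y \<circ> p))\<^sup>2)"
    proof (rule sum.cong[OF refl])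
      fix p assume "p \<in> Sym n"
      then have p: "p permutes {1..n}" by (simp add: Sym_def)
      have "inv (inv p \<circ> transpose x y) = transpose x y \<circ> p"
        using permutes_bij[OF permutes_inv[OF p]] by (simp add: o_inv_distrib permutes_inv_inv[OF p])
      then show "(dif x y (\<lambda>p. f (inv p)) (inv p))\<^sup>2 = (f p - f (transpose x y \<circ> p))\<^sup>2"
        by (simp add: dif_def permutes_inv_inv[OF p])
    qed
    finally show ?thesis .
  qed
  have "ener n (?X - {j}) (\<lambda>p. f (inv p)) = (\<Sum>x\<in>?X - {j}. \<Sum>y\<in>?X. \<Sum>p\<in>Sym n. ?H p x y)"
    unfolding ener_def sqc
    by (rule sum.cong[OF refl], rule sum.mono_neutral_cong_left) auto
  also have "\<dots> = (\<Sum>x\<in>?X. \<Sum>y\<in>?X. \<Sum>p\<in>Sym n. ?H p x y)"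
    by (rule sum.mono_neutral_left) auto
  also have "\<dots> = (\<Sum>p\<in>Sym n. \<Sum>x\<in>?X. \<Sum>y\<in>?X. ?H p x y)"
    by (simp only: sum.swap[of _ "Sym n"])
  also have "\<dots> = (\<Sum>p\<in>Sym n. \<Sum>a\<in>?X. \<Sum>b\<in>?X. of_bool (Inr j \<notin> lines (a, b, p a, p b)) * (dif a b f p)\<^sup>2)"
  proof (rule sum.cong[OF refl])
    fix p assume "p \<in> Sym n"
    then have p: "p permutes ?X" by (simp add: Sym_def)
    note bij = permutes_imp_bij[OF p]
    have "(\<Sum>x\<in>?X. \<Sum>y\<in>?X. ?H p x y) = (\<Sum>a\<in>?X. \<Sum>y\<in>?X. ?H p (p a) y)"
      by (rule sum.reindex_bij_betw[OF bij, symmetric])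
    also have "\<dots> = (\<Sum>a\<in>?X. \<Sum>b\<in>?X. ?H p (p a) (p b))"
      by (rule sum.cong[OF refl], rule sum.reindex_bij_betw[OF bij, symmetric])
    also have "\<dots> = (\<Sum>a\<in>?X. \<Sum>b\<in>?X. of_bool (Inr j \<notin> lines (a, b, p a, p b)) * (dif a b f p)\<^sup>2)"
      by (rule sum.cong[OF refl], rule sum.cong[OF refl])
         (simp add: dif_def permutes_comp_transpose[OF p] lines_def eq_commute[of j])
    finally show "(\<Sum>x\<in>?X. \<Sum>y\<in>?X. ?H p x y) = (\<Sum>a\<in>?X. \<Sum>b\<in>?X. of_bool (Inr j \<notin> lines (a, b, p a, p b)) * (dif a b f p)\<^sup>2)" .
  qed
  also have "\<dots> = (\<Sum>a\<in>?X. \<Sum>b\<in>?X. \<Sum>p\<in>Sym n. of_bool (Inr j \<notin> lines (a, b, p a, p b)) * (dif a b f p)\<^sup>2)"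
    by (simp only: sum.swap[of _ "Sym n"])
  finally show ?thesis .
qed

lemma card_rounding_le:
  fixes h :: "(nat \<Rightarrow> nat) \<Rightarrow> real"
  assumes A: "A \<subseteq> Sym n"
  defines "B \<equiv> {p \<in> Sym n. 1/2 < h p}"
  shows "real (card (A - B \<union> (B - A))) \<le> 4 * (\<Sum>p\<in>Sym n. (of_bool (p \<in> A) - h p)\<^sup>2)"
proof -
  have "real (card (A - B \<union> (B - A))) = (\<Sum>p\<in>A - B \<union> (B - A). 1)" by simp
  also have "\<dots> \<le> (\<Sum>p\<in>A - B \<union> (B - A). 4 * (of_bool (p \<in> A) - h p)\<^sup>2)"
  proof (rule sum_mono)
    fix p assume p: "p \<in> A - B \<union> (B - A)"
    then have "1/2 \<le> \<bar>of_bool (p \<in> A) - h p\<bar>" using A by (auto simp: B_def)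
    then have "(1/2)\<^sup>2 \<le> \<bar>of_bool (p \<in> A) - h p\<bar>\<^sup>2" by (intro power_mono) auto
    then show "1 \<le> 4 * (of_bool (p \<in> A) - h p)\<^sup>2" by (simp add: power2_eq_square)
  qed
  also have "\<dots> \<le> (\<Sum>p\<in>Sym n. 4 * (of_bool (p \<in> A) - h p)\<^sup>2)"
    using A by (intro sum_mono2) (auto simp: B_def)
  finally show ?thesis by (simp only: sum_distrib_left)
qed

lemma dictatorship_row:
  assumes B: "B \<subseteq> Sym n" and i: "i \<in> {1..n}"
    and dep: "\<And>p q. p \<in> B \<Longrightarrow> q \<in> Sym n \<Longrightarrow> p i = q i \<Longrightarrow> q \<in> B"
  shows "dictatorship n B"
  unfolding dictatorship_def
proof (intro exI[of _ "(\<lambda>p. (i, p i)) ` B"] conjI)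
  show "(\<lambda>p. (i, p i)) ` B \<subseteq> {1..n} \<times> {1..n}"
  proof (rule image_subsetI)
    fix p assume "p \<in> B"
    then have "p permutes {1..n}" using B by (auto simp: Sym_def)
    then show "(i, p i) \<in> {1..n} \<times> {1..n}" using i permutes_in_image[of p "{1..n}" i] by blast
  qed
  show "B = (\<Union>p\<in>(\<lambda>p. (i, p i)) ` B. T_set n (fst p) (snd p))"
    using B dep by (fastforce simp: T_set_def)
qed (auto simp: T_set_def)

lemma dictatorship_column:
  assumes B: "B \<subseteq> Sym n" and j: "j \<in> {1..n}"
    and dep: "\<And>p q. p \<in> B \<Longrightarrow> q \<in> Sym n \<Longrightarrow> inv p j = inv q j \<Longrightarrow> q \<in> B"
  shows "dictatorship n B"
  unfolding dictatorship_def
proof (intro exI[of _ "(\<lambda>p. (inv p j, j)) ` B"] conjI)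
  have inv: "inv p j = i \<longleftrightarrow> p i = j" if "p \<in> Sym n" for p i
    using that permutes_inv_eq[of p "{1..n}" j i] by (simp add: Sym_def)
  show "(\<lambda>p. (inv p j, j)) ` B \<subseteq> {1..n} \<times> {1..n}"
  proof (rule image_subsetI)
    fix p assume "p \<in> B"
    then have "inv p permutes {1..n}" using B by (intro permutes_inv) (auto simp: Sym_def)
    then show "(inv p j, j) \<in> {1..n} \<times> {1..n}" using j permutes_in_image[of "inv p" "{1..n}" j] by blast
  qed
  have T: "T_set n i j = {p \<in> Sym n. inv p j = i}" for i
    unfolding T_set_def by (rule Collect_cong) (use inv in blast)
  show "B = (\<Union>p\<in>(\<lambda>p. (inv p j, j)) ` B. T_set n (fst p) (snd p))"
    using B dep by (fastforce simp: T)
  show "\<forall>p\<in>(\<lambda>p. (inv p j, j)) ` B. \<forall>q\<in>(\<lambda>p. (inv p j, j)) ` B. p \<noteq> q \<longrightarrow>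
      T_set n (fst p) (snd p) \<inter> T_set n (fst q) (snd q) = {}"
    by (auto simp: T)
qed

lemma av_eq_of_agree:
  assumes "p \<in> Sym n" "q \<in> Sym n" "q i = p i"
  shows "av ({1..n} - {i}) g q = av ({1..n} - {i}) g p"
proof -
  obtain s where "s permutes ({1..n} - {i})" "q = p \<circ> s"
    using permutes_agree[of p "{1..n}" q "{i}"] assms by (auto simp: Sym_def)
  then show ?thesis by (simp add: av_permute)
qed

text \<open>The average over all positions but \<open>i\<close> is a function of \<open>p i\<close>,
  and the gap bounds its distance from the indicator. The 4 in the gap cancels the 4 lost in
  rounding at 1/2, so only \<open>n - 1\<close> remains.\<close>

lemma ex_dictatorship_of_line:
  assumes A: "A \<subseteq> Sym n" and l: "l \<in> Inl ` {1..n} \<union> Inr ` {1..n}"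
    and en: "(\<Sum>a\<in>{1..n}. \<Sum>b\<in>{1..n}. \<Sum>p\<in>Sym n.
      of_bool (l \<notin> lines (a, b, p a, p b)) * (dif a b (\<lambda>p. of_bool (p \<in> A)) p)\<^sup>2) \<le> E"
  shows "\<exists>B. dictatorship n B \<and> (real n - 1) * real (card (A - B \<union> (B - A))) \<le> E"
proof -
  let ?f = "\<lambda>p. of_bool (p \<in> A) :: real"
  from l consider i where "i \<in> {1..n}" "l = Inl i" | j where "j \<in> {1..n}" "l = Inr j" by blast
  then show ?thesis
  proof cases
    case 1
    let ?X = "{1..n} - {i}"
    define B where "B = {p \<in> Sym n. 1/2 < av ?X ?f p}"
    have n: "real (card ?X) = real n - 1" "real n - 1 \<ge> 0" using 1(1) by (auto simp: of_nat_diff)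
    have "dictatorship n B"
    proof (rule dictatorship_row[OF _ 1(1)])
      fix p q assume "p \<in> B" "q \<in> Sym n" "p i = q i"
      then show "q \<in> B" using av_eq_of_agree[of p n q i ?f] by (simp add: B_def)
    qed (auto simp: B_def)
    moreover have "(real n - 1) * real (card (A - B \<union> (B - A))) \<le> (real n - 1) * (4 * sq n (\<lambda>p. ?f p - av ?X ?f p))"
      using n card_rounding_le[OF A, of "av ?X ?f"] by (intro mult_left_mono) (auto simp: B_def sq_def)
    moreover have "(real n - 1) * (4 * sq n (\<lambda>p. ?f p - av ?X ?f p)) \<le> E"
    proof -
      have "4 * real (card ?X) * sq n (\<lambda>p. ?f p - av ?X ?f p) \<le> E"
        by (rule order_trans[OF spectral_gap]) (use en in \<open>auto simp: 1(2) ener_row\<close>)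
      then show ?thesis unfolding n(1)[symmetric] by (simp only: mult_ac)
    qed
    ultimately show ?thesis by force
  next
    case 2
    let ?X = "{1..n} - {j}"
    let ?g = "\<lambda>p. ?f (inv p)"
    define B where "B = {p \<in> Sym n. 1/2 < av ?X ?g (inv p)}"
    have n: "real (card ?X) = real n - 1" "real n - 1 \<ge> 0" using 2(1) by (auto simp: of_nat_diff)
    have "dictatorship n B"
    proof (rule dictatorship_column[OF _ 2(1)])
      fix p q assume pq: "p \<in> B" "q \<in> Sym n" "inv p j = inv q j"
      then have "inv p \<in> Sym n" "inv q \<in> Sym n" by (auto simp: B_def Sym_def permutes_inv)
      then show "q \<in> B" using av_eq_of_agree[of "inv p" n "inv q" j ?g] pq by (simp add: B_def)
    qed (auto simp: B_def)
    moreover have "real (card (A - B \<union> (B - A))) \<le> 4 * sq n (\<lambda>p. ?g p - av ?X ?g p)"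
    proof -
      have "(\<Sum>p\<in>Sym n. (?f p - av ?X ?g (inv p))\<^sup>2) = (\<Sum>p\<in>Sym n. (?g (inv p) - av ?X ?g (inv p))\<^sup>2)"
        by (rule sum.cong[OF refl]) (simp add: Sym_def permutes_inv_inv)
      also have "\<dots> = sq n (\<lambda>p. ?g p - av ?X ?g p)"
        unfolding sq_def by (rule sum_Sym_inv)
      finally show ?thesis using card_rounding_le[OF A, of "\<lambda>p. av ?X ?g (inv p)"] by (simp add: B_def)
    qed
    then have "(real n - 1) * real (card (A - B \<union> (B - A))) \<le> (real n - 1) * (4 * sq n (\<lambda>p. ?g p - av ?X ?g p))"
      using n by (intro mult_left_mono) auto
    moreover have "(real n - 1) * (4 * sq n (\<lambda>p. ?g p - av ?X ?g p)) \<le> E"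
    proof -
      have "4 * real (card ?X) * sq n (\<lambda>p. ?g p - av ?X ?g p) \<le> E"
        by (rule order_trans[OF spectral_gap]) (use en in \<open>auto simp: 2(2) ener_column[of _ _ ?f]\<close>)
      then show ?thesis unfolding n(1)[symmetric] by (simp only: mult_ac)
    qed
    ultimately show ?thesis by force
  qed
qed

lemma ex_dictatorship:
  assumes n: "n \<ge> 20" and A: "A \<subseteq> Sym n" and card: "real (card A) = c * fact n"
    and \<eta>: "0 \<le> \<eta>" "\<eta> \<le> 1/4"
    and bd: "real (card (edge_boundary n A)) \<le> real n * fact n * (c * (1 - c) + \<eta>)"
  shows "\<exists>B. dictatorship n B \<and> real (card (A - B \<union> (B - A))) \<le> 1384 * fact n * (sqrt \<eta> + 1 / sqrt (real n))"
proof -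
  let ?X = "{1..n}"
  let ?f = "\<lambda>p. of_bool (p \<in> A) :: real"
  define N where "N = (fact n :: real)"
  have f01: "?f p = 0 \<or> ?f p = 1" for p by simp
  have en: "ener n ?X ?f \<le> 4 * real n * fact n * (c * (1 - c) + \<eta>)"
    using ener_indicator_le[OF A] bd by simp
  have mean: "(\<Sum>p\<in>Sym n. ?f p) = c * fact n" using card A by (simp add: Int_absorb1)
  have err: "(\<Sum>a\<in>?X. \<Sum>b\<in>?X. sq n (\<lambda>p. dif a b ?f p - psi n ?f a b p)) \<le> 16 * real n * fact n * \<eta>"
    by (rule sum_sq_dif_minus_psi_le[OF _ f01 mean en \<eta>(1)]) (use n in simp)
  have small: "real (card (rects n ?f)) \<le> 8 * real n ^ 3"
  proof (rule card_rects_le)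
    have "(\<Sum>a\<in>?X. \<Sum>b\<in>?X. sq n (psi n ?f a b)) \<le> ener n ?X ?f"
      unfolding ener_def
    proof (intro sum_mono)
      fix a b
      show "sq n (psi n ?f a b) \<le> sq n (dif a b ?f)"
        using sq_minus_av[of "?X - {a,b}" n "dif a b ?f"] sq_nonneg[of n "\<lambda>p. dif a b ?f p - av (?X - {a,b}) (dif a b ?f) p"]
        unfolding psi_def by simp
    qed
    also have "\<dots> \<le> 4 * real n * fact n * (1/2)"
    proof -
      \<comment> \<open>Together with \<open>\<eta> \<le> 1/4\<close> this yields the factor 1/2
        required by \<open>card_rects_le\<close>.\<close>
      have "c * (1 - c) \<le> 1/4" using zero_le_power2[of "c - 1/2"] by (simp add: power2_eq_square algebra_simps)
      then have "4 * real n * fact n * (c * (1 - c) + \<eta>) \<le> 4 * real n * fact n * (1/2)"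
        using \<eta> by (intro mult_left_mono) auto
      with en show ?thesis by linarith
    qed
    finally show "(\<Sum>a\<in>?X. \<Sum>b\<in>?X. sq n (psi n ?f a b)) \<le> 2 * real n * fact n" by linarith
  qed (use n in simp)
  \<comment> \<open>\<open>157^2 = 24649\<close> is just above the 24576 of
    \<open>card_disjoint_rects_bound\<close>.\<close>
  define B where "B = 157 * sqrt \<eta> * real n ^ 3"
  have B0: "B \<ge> 0" using \<eta> by (simp add: B_def)
  have B2: "B\<^sup>2 = 24649 * \<eta> * real n ^ 6"
    using \<eta> by (simp add: B_def power_mult_distrib flip: power_mult)
  have "real (card (disjoint_pairs (rects n ?f) (rects n ?f))) \<le> 24576 * \<eta> * real n ^ 6"
    by (rule card_disjoint_rects_bound[OF n f01 small err \<eta>(1)])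
  also have "\<dots> \<le> B\<^sup>2" unfolding B2 using \<eta> by (intro mult_right_mono) auto
  finally have dj: "real (card (disjoint_pairs (rects n ?f) (rects n ?f))) \<le> B\<^sup>2" .
  have sub: "rects n ?f \<subseteq> quads n" using rects_subset[of n ?f] by (auto simp: quads_def)
  obtain l where l: "l \<in> Inl ` ?X \<union> Inr ` ?X"
    and lc: "real (card {R \<in> rects n ?f. l \<notin> lines R}) \<le> B + 3 * sqrt (B\<^sup>2 + 32 * real n ^ 5)"
    using concentrated_on_line[OF sub _ B0 dj] n by auto
  define r where "r = sqrt \<eta> + 1 / sqrt (real n)"
  have sn: "sqrt (real n) > 0" using n by simp
  \<comment> \<open>\<open>n ^ 3 / sqrt n\<close> is the square root of \<open>n ^ 5\<close>, and
    \<open>6^2\<close> exceeds 32.\<close>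
  have "sqrt (B\<^sup>2 + 32 * real n ^ 5) \<le> B + 6 * (real n ^ 3 / sqrt (real n))"
  proof (rule real_le_lsqrt[THEN order_trans[OF _ order_refl]])
    have "(real n ^ 3 / sqrt (real n))\<^sup>2 = real n ^ 5"
      using n by (simp add: power_divide flip: power_mult) (simp add: power_eq_if)
    moreover have "(B + 6 * w)\<^sup>2 = B\<^sup>2 + 36 * w\<^sup>2 + 12 * B * w" for w
      by (simp add: power2_eq_square algebra_simps)
    ultimately have "(B + 6 * (real n ^ 3 / sqrt (real n)))\<^sup>2 = B\<^sup>2 + 36 * real n ^ 5 + 12 * B * (real n ^ 3 / sqrt (real n))"
      by (simp only:)
    moreover have "0 \<le> 12 * B * (real n ^ 3 / sqrt (real n))" using B0 by simp
    moreover have "32 * real n ^ 5 \<le> 36 * real n ^ 5" by simp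
    ultimately show "B\<^sup>2 + 32 * real n ^ 5 \<le> (B + 6 * (real n ^ 3 / sqrt (real n)))\<^sup>2" by linarith
  qed (use B0 in auto)
  then have "real (card {R \<in> rects n ?f. l \<notin> lines R}) \<le> 4 * B + 18 * (real n ^ 3 / sqrt (real n))"
    using lc by linarith
  also have "\<dots> = real n ^ 3 * (628 * sqrt \<eta> + 18 * (1 / sqrt (real n)))" by (simp add: B_def algebra_simps)
  also have "\<dots> \<le> real n ^ 3 * (628 * r)"
  proof -
    have "18 * (1 / sqrt (real n)) \<le> 628 * (1 / sqrt (real n))" using sn by (intro mult_right_mono) auto
    then show ?thesis unfolding r_def distrib_left[of 628] by (intro mult_left_mono add_left_mono) auto
  qed
  finally have cl: "real (card {R \<in> rects n ?f. l \<notin> lines R}) \<le> real n ^ 3 * (628 * r)" .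
  have \<eta>r: "\<eta> \<le> r"
  proof -
    have "\<eta> * \<eta> \<le> \<eta> * 1" using \<eta> by (intro mult_left_mono) auto
    then have "\<eta> \<le> sqrt \<eta>" using \<eta> by (intro real_le_rsqrt) (simp add: power2_eq_square)
    then show ?thesis using sn by (simp add: r_def add_increasing2)
  qed
  have r0: "r \<ge> 0" using \<eta>r \<eta> by linarith
  have "(\<Sum>a\<in>?X. \<Sum>b\<in>?X. \<Sum>p\<in>Sym n. of_bool (l \<notin> lines (a, b, p a, p b)) * (dif a b ?f p)\<^sup>2)
      \<le> fact (n - 2) * real (card {R \<in> rects n ?f. l \<notin> lines R})
        + 4 * (\<Sum>a\<in>?X. \<Sum>b\<in>?X. sq n (\<lambda>p. dif a b ?f p - psi n ?f a b p))"
    by (rule sum_restricted_dif_le[OF f01])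
  also have "\<dots> \<le> fact (n - 2) * (real n ^ 3 * (628 * r)) + 4 * (16 * real n * N * r)"
  proof (intro add_mono mult_left_mono cl)
    have "16 * real n * N * \<eta> \<le> 16 * real n * N * r" using \<eta>r by (intro mult_left_mono) (auto simp: N_def)
    then show "(\<Sum>a\<in>?X. \<Sum>b\<in>?X. sq n (\<lambda>p. dif a b ?f p - psi n ?f a b p)) \<le> 16 * real n * N * r"
      using err by (simp add: N_def)
  qed auto
  finally obtain D where D: "dictatorship n D"
    and cD: "(real n - 1) * real (card (A - D \<union> (D - A))) \<le> fact (n - 2) * (real n ^ 3 * (628 * r)) + 4 * (16 * real n * N * r)"
    using ex_dictatorship_of_line[OF A l] by blast
  have n1: "real n - 1 > 0" using n by simp
  have nn: "real n \<le> 20/19 * (real n - 1)" using n by simp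
  have NF: "N = real n * (real n - 1) * fact (n - 2)" unfolding N_def using n by (intro fact_split2) simp
  have sqn: "real n ^ 2 \<le> 2 * (real n - 1)\<^sup>2"
  proof -
    have "real n ^ 2 \<le> (20/19 * (real n - 1)) ^ 2" using nn by (intro power_mono) auto
    also have "\<dots> = (400/361) * (real n - 1)\<^sup>2" by (simp only: power_mult_distrib) (simp add: power2_eq_square)
    also have "\<dots> \<le> 2 * (real n - 1)\<^sup>2" by (intro mult_right_mono) auto
    finally show ?thesis .
  qed
  have "fact (n - 2) * (real n ^ 3 * (628 * r)) \<le> (real n - 1) * (2 * N * (628 * r))"
  proof -
    have "fact (n - 2) * (real n ^ 3 * (628 * r)) = (fact (n - 2) * real n * (628 * r)) * real n ^ 2"
      by (simp add: power2_eq_square power3_eq_cube)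
    also have "\<dots> \<le> (fact (n - 2) * real n * (628 * r)) * (2 * (real n - 1)\<^sup>2)"
      using sqn r0 by (intro mult_left_mono) auto
    also have "\<dots> = (real n - 1) * (2 * N * (628 * r))"
      unfolding NF by (simp add: power2_eq_square)
    finally show ?thesis .
  qed
  moreover have "4 * (16 * real n * N * r) \<le> (real n - 1) * (128 * N * r)"
  proof -
    have "(64 * N * r) * real n \<le> (64 * N * r) * (2 * (real n - 1))"
      using n r0 by (intro mult_left_mono) (auto simp: N_def)
    then show ?thesis by (simp add: mult_ac)
  qed
  ultimately have "(real n - 1) * real (card (A - D \<union> (D - A))) \<le> (real n - 1) * (2 * N * (628 * r) + 128 * N * r)"
    using cD unfolding distrib_left[of "real n - 1"] by linarith
  then have "real (card (A - D \<union> (D - A))) \<le> 2 * N * (628 * r) + 128 * N * r"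
    using n1 by (rule mult_left_le_imp_le)
  \<comment> \<open>\<open>1384 = 2 * 628 + 128\<close>, where \<open>628 = 4 * 157\<close>.\<close>
  then have "real (card (A - D \<union> (D - A))) \<le> 1384 * fact n * r" unfolding N_def by linarith
  with D show ?thesis unfolding r_def by blast
qed

lemma sqrt_le_powr_seventh: "0 \<le> x \<Longrightarrow> x \<le> 1 \<Longrightarrow> sqrt x \<le> x powr (1/7)"
  by (cases "x = 0") (auto simp: powr_half_sqrt[symmetric] intro!: powr_mono')

lemma inverse_sqrt_le: "1 \<le> x \<Longrightarrow> 1 / sqrt x \<le> 1 / x powr (1/3)"
  by (intro divide_left_mono mult_pos_pos) (auto simp: powr_half_sqrt[symmetric] intro!: powr_mono)

theorem theorem4p4:
  shows "\<exists>C::real. C > 0 \<and>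
    (\<forall>(n::nat) (A::(nat \<Rightarrow> nat) set) (c::real) (\<delta>\<^sub>0::real).
       A \<subseteq> Sym n \<and> real (card A) = c * fact n \<and> 0 < c \<and> c < 1 \<and> \<delta>\<^sub>0 \<ge> 0 \<and>
       real (card (edge_boundary n A)) \<le> (1 - c + \<delta>\<^sub>0) * real n * real (card A)
       \<longrightarrow> (\<exists>B. dictatorship n B \<and>
             real (card (A - B \<union> (B - A))) / fact n
               \<le> C / (c * (1 - c)) * ((c * \<delta>\<^sub>0) powr (1/7) + 1 / real n powr (1/3))))"
proof (intro exI[of _ "1384::real"] conjI allI impI)
  fix n :: nat and A :: "(nat \<Rightarrow> nat) set" and c \<delta>\<^sub>0 :: real
  assume "A \<subseteq> Sym n \<and> real (card A) = c * fact n \<and> 0 < c \<and> c < 1 \<and> \<delta>\<^sub>0 \<ge> 0 \<and>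
       real (card (edge_boundary n A)) \<le> (1 - c + \<delta>\<^sub>0) * real n * real (card A)"
  then have A: "A \<subseteq> Sym n" and card: "real (card A) = c * fact n" and c: "0 < c" "c < 1" and \<delta>: "\<delta>\<^sub>0 \<ge> 0"
    and bd: "real (card (edge_boundary n A)) \<le> (1 - c + \<delta>\<^sub>0) * real n * real (card A)" by auto
  \<comment> \<open>The excess over the least possible boundary, in units of
    \<open>n * fact n\<close>.\<close>
  define \<eta> where "\<eta> = c * \<delta>\<^sub>0"
  define T where "T = \<eta> powr (1/7) + 1 / real n powr (1/3)"
  have \<eta>: "\<eta> \<ge> 0" using c \<delta> by (simp add: \<eta>_def)
  have T0: "T \<ge> 0" by (simp add: T_def)
  have q: "0 < c * (1 - c)" "c * (1 - c) \<le> 1" using c by (auto intro: mult_le_one)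
  have scale: "1384 * T \<le> 1384 / (c * (1 - c)) * T"
    using q T0 by (intro mult_right_mono) (auto simp: field_simps)
  \<comment> \<open>Once the bound is at least 1 the empty dictatorship suffices, since
    \<open>A\<close> has density below 1.\<close>
  have trivial: "\<exists>B. dictatorship n B \<and> real (card (A - B \<union> (B - A))) / fact n \<le> 1384 / (c * (1 - c)) * T" if "1 \<le> 1384 * T"
  proof (intro exI[of _ "{}"] conjI)
    show "dictatorship n {}" by (auto simp: dictatorship_def)
    show "real (card (A - {} \<union> ({} - A))) / fact n \<le> 1384 / (c * (1 - c)) * T"
      using that scale c card by simp
  qed
  \<comment> \<open>At \<open>n = 0\<close> the last term of the bound would be
    \<open>1 / 0 = 0\<close> and give nothing; but then \<open>card A = c\<close> would be an
    integer strictly between 0 and 1.\<close>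
  have n0: "n > 0"
  proof (rule ccontr)
    assume "\<not> n > 0"
    then have "real (card A) = c" using card by simp
    then have "0 < card A" "card A < 1" using c by auto
    then show False by simp
  qed
  consider "\<eta> > 1/4" | "n < 20" | "\<eta> \<le> 1/4" "n \<ge> 20" by linarith
  then have "\<exists>B. dictatorship n B \<and> real (card (A - B \<union> (B - A))) / fact n \<le> 1384 / (c * (1 - c)) * T"
  proof cases
    case 1
    have "(1/4 :: real) powr 1 \<le> (1/4) powr (1/7)" by (rule powr_mono') auto
    also have "\<dots> \<le> \<eta> powr (1/7)" using 1 by (intro powr_mono2) auto
    finally have "1/4 \<le> \<eta> powr (1/7)" by simp
    moreover have "0 \<le> 1 / real n powr (1/3)" by simp
    ultimately have "1/4 \<le> T" unfolding T_def by linarith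
    then show ?thesis by (intro trivial) simp
  next
    case 2
    have "real n powr (1/3) \<le> real n powr 1" using n0 by (intro powr_mono) auto
    then have "real n powr (1/3) \<le> 20" using 2 by simp
    then have "1 / 20 \<le> 1 / real n powr (1/3)" using n0 by (intro divide_left_mono) auto
    moreover have "0 \<le> \<eta> powr (1/7)" by simp
    ultimately have "1/20 \<le> T" unfolding T_def by linarith
    then show ?thesis by (intro trivial) simp
  next
    case 3
    have "real (card (edge_boundary n A)) \<le> real n * fact n * (c * (1 - c) + \<eta>)"
      using bd unfolding card \<eta>_def by (simp add: algebra_simps)
    then obtain B where B: "dictatorship n B"
      "real (card (A - B \<union> (B - A))) \<le> 1384 * fact n * (sqrt \<eta> + 1 / sqrt (real n))"
      using ex_dictatorship[OF 3(2) A card \<eta> 3(1)] by blast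
    have "real (card (A - B \<union> (B - A))) / fact n \<le> 1384 * (sqrt \<eta> + 1 / sqrt (real n))"
      using B(2) by (simp add: pos_divide_le_eq mult_ac)
    also have "\<dots> \<le> 1384 * T"
      unfolding T_def using \<eta> 3 n0 by (intro mult_left_mono add_mono sqrt_le_powr_seventh inverse_sqrt_le) auto
    also note scale
    finally show ?thesis using B(1) by blast
  qed
  then show "\<exists>B. dictatorship n B \<and> real (card (A - B \<union> (B - A))) / fact n
      \<le> 1384 / (c * (1 - c)) * ((c * \<delta>\<^sub>0) powr (1/7) + 1 / real n powr (1/3))"
    by (simp only: T_def \<eta>_def)
qed simp

end
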